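(* Let $(X,\mu)$ be a $1$-dimensional OU pair. Then $\mathcal{H}_{bac}(X,\mu)$, with the topology $\tau_{ac}$, is not Roelcke precompact. More precisely, any sequence $(g_n)_{n\in\mathbb{N}}\subset\mathcal{H}_{bac}(X,\mu)$ such that - $(g_n)_{n\in\mathbb{N}}$ converges to the identity in $\tau_{co}$, and - $(g_n)_{n\in\mathbb{N}}$ does not converge to the identity in $\tau_{ac}$, is not totally bounded for the Roelcke uniformity of $(\mathcal{H}_{bac}(X,\mu),\tau_{ac})$. In particular $\mathcal{H}_{bac}(X,\mu)$ is not Roelcke precompact.
   Context: An OU (Oxtoby–Ulam) pair $(X,\mu)$ consists of a compact connected topological manifold $X$ (possibly with boundary $\partial X$) and a finite Borel measure $\mu$ on $X$ with $\mu(U)>0$ for all non-empty open $U\subseteq X$, $\mu(\{x\})=0$ for all $x\in X$, and $\mu(\partial X)=0$. $\mathcal{H}(X)$ is the group of homeomorphisms of $X$, and $\mathcal{H}_{bac}(X,\mu)$ is the subgroup of all $g\in\mathcal{H}(X)$ such that for every Borel set $A$ one has $\mu(A)=0$ iff $\mu(g(A))=0$. For $g\in\mathcal{H}_{bac}(X,\mu)$, $\mathcal{D}(g)\in L^1(X,\mu)$ is the Radon–Nikodym derivative of $A\mapsto\mu(g(A))$ with respect to $\mu$, and $\rho_{ac}(g,h):=\|\mathcal{D}(g)-\mathcal{D}(h)\|_{L^1(X,\mu)}$. $\tau_{co}$ is the restriction to $\mathcal{H}_{bac}(X,\mu)$ of the compact-open topology (uniform convergence), and $\tau_{ac}$ is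 the topology generated by $\tau_{co}$ together with the topology induced by $\rho_{ac}$. A subset $S$ of a topological group $G$ is totally bounded for the Roelcke uniformity if for every neighborhood $\mathcal{V}$ of the identity there are finitely many $h_1,\dots,h_r\in G$ with $S\subseteq\bigcup_{l=1}^r\mathcal{V}h_l\mathcal{V}$; $G$ is Roelcke precompact if $G$ itself is totally bounded for the Roelcke uniformity. *)

theory Defs
  imports "HOL-Analysis.Analysis" "HOL-Algebra.Coset"
begin

section \<open>Topological manifolds with boundary\<close>

definition Euclidean_half_space :: "nat \<Rightarrow> (nat \<Rightarrow> real) topology" where
  "Euclidean_half_space n = subtopology (Euclidean_space n) {x. 0 \<le> x 0}"

definition topological_manifold :: "nat \<Rightarrow> 'a topology \<Rightarrow> bool" where
  "topological_manifold n X \<longleftrightarrow>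
     Hausdorff_space X \<and> second_countable X \<and>
     (\<forall>x \<in> topspace X. \<exists>U V. openin X U \<and> x \<in> U \<and> openin (Euclidean_half_space n) V \<and>
        subtopology X U homeomorphic_space subtopology (Euclidean_half_space n) V)"

definition manifold_boundary :: "nat \<Rightarrow> 'a topology \<Rightarrow> 'a set" where
  "manifold_boundary n X =
     {x \<in> topspace X. \<not> (\<exists>U V. openin X U \<and> x \<in> U \<and> openin (Euclidean_space n) V \<and>
        subtopology X U homeomorphic_space subtopology (Euclidean_space n) V)}"

section \<open>Oxtoby--Ulam pairs\<close>

text \<open>
  A connected space is understood to be nonempty; \<^const>\<open>connected_space\<close> also holds of the
  empty space, which therefore has to be excluded separately.
\<close>

definition OU_pair :: "nat \<Rightarrow> 'a topology \<Rightarrow> 'a measure \<Rightarrow> bool" where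
  "OU_pair n X \<mu> \<longleftrightarrow>
     topological_manifold n X \<and> compact_space X \<and> connected_space X \<and> topspace X \<noteq> {} \<and>
     space \<mu> = topspace X \<and> sets \<mu> = sigma_sets (topspace X) {U. openin X U} \<and>
     finite_measure \<mu> \<and>
     (\<forall>U. openin X U \<and> U \<noteq> {} \<longrightarrow> 0 < emeasure \<mu> U) \<and>
     (\<forall>x \<in> topspace X. {x} \<in> null_sets \<mu>) \<and>
     manifold_boundary n X \<in> null_sets \<mu>"

section \<open>Groups of homeomorphisms\<close>

text \<open>
  Homeomorphisms are represented by extensional functions, so that two homeomorphisms that agree
  on the space are equal.
\<close>

definition homeo_group :: "'a topology \<Rightarrow> ('a \<Rightarrow> 'a) monoid" where
  "homeo_group X =
     \<lparr>carrier = {g. g \<in> extensional (topspace X) \<and> homeomorphic_map X X g},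
      mult = (\<lambda>g h. compose (topspace X) g h),
      one = (\<lambda>x \<in> topspace X. x)\<rparr>"

definition H_bac :: "'a topology \<Rightarrow> 'a measure \<Rightarrow> ('a \<Rightarrow> 'a) monoid" where
  "H_bac X \<mu> = (homeo_group X)
     \<lparr>carrier := {g \<in> carrier (homeo_group X).
        \<forall>A \<in> sets \<mu>. emeasure \<mu> A = 0 \<longleftrightarrow> emeasure \<mu> (g ` A) = 0}\<rparr>"

definition RN_derivative :: "'a measure \<Rightarrow> ('a \<Rightarrow> 'a) \<Rightarrow> 'a \<Rightarrow> real" where
  "RN_derivative \<mu> g x =
     enn2real (RN_deriv \<mu> (measure_of (space \<mu>) (sets \<mu>) (\<lambda>A. emeasure \<mu> (g ` A))) x)"

definition rho_ac :: "'a measure \<Rightarrow> ('a \<Rightarrow> 'a) \<Rightarrow> ('a \<Rightarrow> 'a) \<Rightarrow> real" where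
  "rho_ac \<mu> g h = (\<integral>x. \<bar>RN_derivative \<mu> g x - RN_derivative \<mu> h x\<bar> \<partial>\<mu>)"

section \<open>Topologies on the group\<close>

definition compact_open_topology :: "'a topology \<Rightarrow> 'b topology \<Rightarrow> ('a \<Rightarrow> 'b) topology" where
  "compact_open_topology X Y = topology_generated_by
     {{f. f \<in> extensional (topspace X) \<and> continuous_map X Y f \<and> f ` K \<subseteq> U} | K U.
        compactin X K \<and> openin Y U}"

definition tau_co :: "'a topology \<Rightarrow> 'a measure \<Rightarrow> ('a \<Rightarrow> 'a) topology" where
  "tau_co X \<mu> = subtopology (compact_open_topology X X) (carrier (H_bac X \<mu>))"

text \<open>
  In general \<^const>\<open>rho_ac\<close> is only a pseudometric (measure preserving homeomorphisms all have
  derivative 1), so its topology is introduced through open balls and not through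
  \<^locale>\<open>Metric_space\<close>.
\<close>

definition pseudometric_topology :: "'b set \<Rightarrow> ('b \<Rightarrow> 'b \<Rightarrow> real) \<Rightarrow> 'b topology" where
  "pseudometric_topology S d =
     topology_generated_by {{y \<in> S. d x y < r} | x r. x \<in> S \<and> 0 < r}"

definition tau_ac :: "'a topology \<Rightarrow> 'a measure \<Rightarrow> ('a \<Rightarrow> 'a) topology" where
  "tau_ac X \<mu> = topology_generated_by
     ({W. openin (tau_co X \<mu>) W} \<union>
      {W. openin (pseudometric_topology (carrier (H_bac X \<mu>)) (rho_ac \<mu>)) W})"

section \<open>Roelcke precompactness\<close>

definition roelcke_totally_bounded ::
    "('g, 'm) monoid_scheme \<Rightarrow> 'g topology \<Rightarrow> 'g set \<Rightarrow> bool" where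
  "roelcke_totally_bounded G T S \<longleftrightarrow>
     (\<forall>V. V \<subseteq> carrier G \<and> (\<exists>W. openin T W \<and> \<one>\<^bsub>G\<^esub> \<in> W \<and> W \<subseteq> V) \<longrightarrow>
        (\<exists>F. finite F \<and> F \<subseteq> carrier G \<and> S \<subseteq> (\<Union>h\<in>F. (V #>\<^bsub>G\<^esub> h) <#>\<^bsub>G\<^esub> V)))"

definition roelcke_precompact :: "('g, 'm) monoid_scheme \<Rightarrow> 'g topology \<Rightarrow> bool" where
  "roelcke_precompact G T \<longleftrightarrow> roelcke_totally_bounded G T (carrier G)"

end

theory Submission
  imports Defs "HOL-Probability.Distribution_Functions"
begin

text \<open>
Write \<open>\<mu>\<^sub>g(A) = \<mu>(g(A))\<close>. Since \<open>\<mu>\<^sub>g\<close> and \<open>\<mu>\<close> have the same total mass, the \<open>L\<^sup>1\<close>-distance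
of their densities is twice the largest value of \<open>\<mu>(g(A)) - \<mu>(A)\<close> over Borel sets \<open>A\<close>. Hence
\<open>rho_ac(id, g) < d\<close> controls \<open>\<bar>\<mu>(g(A)) - \<mu>(A)\<bar>\<close> for all \<open>A\<close> at once, and conversely
(\<open>measure_image_diff_le_rho_ac\<close>, \<open>rho_ac_eq_measure_image_diff\<close>).

Dimension one enters through sets with finite frontier. Points have neighbourhoods with at most two
frontier points, so sets with finite frontier are dense in the Borel sets for every finite measure
(\<open>approximation_by_finite_frontier\<close>). If \<open>g\<close> is uniformly close to the identity, then \<open>g(B)\<close> and
\<open>B\<close> differ only near the frontier of \<open>B\<close>; as points are null, \<open>\<bar>\<mu>(g(B)) - \<mu>(B)\<bar>\<close> is small, with
a bound that depends only on the number of frontier points of \<open>B\<close>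
(\<open>tau_co_limit_measure_image_finite_frontier\<close>).

Let now \<open>g\<^sub>n \<rightarrow> id\<close> uniformly and suppose that finitely many sets \<open>V h V\<close> cover the sequence,
where \<open>V\<close> is the \<open>rho_ac\<close>-ball of radius \<open>d\<close> around the identity. Let \<open>rho_ac(id, g\<^sub>n) \<ge> r\<close>
for infinitely many \<open>n\<close>. For infinitely many of these, \<open>g\<^sub>n = v\<^sub>n h w\<^sub>n\<close> with one and the same \<open>h\<close>. For a set
\<open>A\<close> with finite frontier put \<open>B\<^sub>n = w\<^sub>n\<^sup>-\<^sup>1(A)\<close>, so that \<open>g\<^sub>n(B\<^sub>n) = v\<^sub>n(h(A))\<close>. All \<open>B\<^sub>n\<close> have as many
frontier points as \<open>A\<close>, hence \<open>\<mu>(g\<^sub>n(B\<^sub>n)) - \<mu>(B\<^sub>n) \<rightarrow> 0\<close> although \<open>B\<^sub>n\<close> varies with \<open>n\<close>. Now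
\<open>\<mu>(h(A))\<close> is within \<open>d/2\<close> of \<open>\<mu>(g\<^sub>n(B\<^sub>n))\<close>, and \<open>\<mu>(B\<^sub>n)\<close> is within \<open>d/2\<close> of \<open>\<mu>(A)\<close>. By
density \<open>\<bar>\<mu>(h(A)) - \<mu>(A)\<bar> \<le> d\<close> for all Borel sets \<open>A\<close>. Adding up the contributions of \<open>w\<^sub>n\<close>, \<open>h\<close> and
\<open>v\<^sub>n\<close> gives \<open>rho_ac(id, g\<^sub>n) \<le> 4 d\<close>, which is absurd for \<open>d = r/5\<close>
(\<open>not_roelcke_totally_bounded_if_tau_co_limit\<close>).

It remains to find one sequence to which this applies. An arc in \<open>X\<close> can be parametrized by its own measure,
because \<open>\<mu>\<close> has no atoms and full support (\<open>measure_parametrized_arc_exists\<close>). In this parameter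
\<open>\<mu>\<close> is Lebesgue measure on \<open>[0, L]\<close>, and
\<open>\<phi>\<^sub>n(t) = t + c\<^sub>n (1 - cos(\<omega>\<^sub>n t))\<close> with \<open>c\<^sub>n \<omega>\<^sub>n = 1/2\<close> and \<open>\<omega>\<^sub>n \<rightarrow> \<infty>\<close> is bi-Lipschitz
with uniform constants and tends to the identity uniformly, while its derivative keeps oscillating between
\<open>1/2\<close> and \<open>3/2\<close> (\<open>tau_co_limit_not_tau_ac_limit_exists\<close>).
\<close>

section \<open>Convergence in generated topologies\<close>

text \<open>
Subbasic neighbourhoods suffice: if sets around the limit are eventually entered, then so are their
finite intersections and every union with such a member.
\<close>
lemma limitin_topology_generated_by:
  "limitin (topology_generated_by S) f l F \<longleftrightarrow>
     l \<in> \<Union>S \<and> (\<forall>U\<in>S. l \<in> U \<longrightarrow> (\<forall>\<^sub>F x in F. f x \<in> U))"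
proof (intro iffI conjI ballI impI)
  assume "limitin (topology_generated_by S) f l F"
  then show "l \<in> \<Union>S" "\<And>U. U \<in> S \<Longrightarrow> l \<in> U \<Longrightarrow> \<forall>\<^sub>F x in F. f x \<in> U"
    by (auto simp: limitin_def topology_generated_by_Basis)
next
  assume *: "l \<in> \<Union>S \<and> (\<forall>U\<in>S. l \<in> U \<longrightarrow> (\<forall>\<^sub>F x in F. f x \<in> U))"
  have "\<forall>\<^sub>F x in F. f x \<in> U" if "generate_topology_on S U" "l \<in> U" for U
    using that
  proof (induction rule: generate_topology_on.induct)
    case (Int a b)
    then show ?case by (auto intro: eventually_conj)
  next
    case (UN K)
    then obtain k where "k \<in> K" "l \<in> k" by blast
    with UN have "\<forall>\<^sub>F x in F. f x \<in> k" by blast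
    then show ?case
      by (rule eventually_mono) (use \<open>k \<in> K\<close> in blast)
  qed (use * in auto)
  then show "limitin (topology_generated_by S) f l F"
    using * by (simp add: limitin_def openin_topology_generated_by_iff)
qed

lemma limitin_topology_generated_by_Un:
  assumes "l \<in> topspace S" "l \<in> topspace T"
  shows "limitin (topology_generated_by ({W. openin S W} \<union> {W. openin T W})) f l F \<longleftrightarrow>
    limitin S f l F \<and> limitin T f l F"
proof -
  have "l \<in> \<Union>({W. openin S W} \<union> {W. openin T W})" using assms(1) openin_topspace by blast
  then show ?thesis
    unfolding limitin_topology_generated_by ball_Un
    using assms by (simp add: limitin_def imp_conjL)
qed

section \<open>Derivatives of homeomorphisms\<close>

locale finite_borel_measure_on =
  finite_measure \<mu> for X :: "'a topology" and \<mu> :: "'a measure" +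
  assumes space_eq: "space \<mu> = topspace X"
    and sets_eq: "sets \<mu> = sigma_sets (topspace X) {U. openin X U}"
begin

lemma openin_sets: "openin X U \<Longrightarrow> U \<in> sets \<mu>"
  by (simp add: sets_eq)

lemma closedin_sets: "closedin X C \<Longrightarrow> C \<in> sets \<mu>"
  using openin_sets[of "topspace X - C"] sets.compl_sets[of "topspace X - C" \<mu>]
  by (simp add: closedin_def space_eq double_diff)

lemma homeomorphic_image_sets:
  assumes g: "homeomorphic_map X X g" and A: "A \<in> sets \<mu>"
  shows "g ` A \<in> sets \<mu>"
proof -
  have inj: "inj_on g (topspace X)" and onto: "g ` topspace X = topspace X"
    using g by (auto simp: homeomorphic_eq_everything_map)
  have "A \<in> sigma_sets (topspace X) {U. openin X U}" using A sets_eq by simp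
  then show ?thesis
  proof (induction rule: sigma_sets.induct)
    case (Basic U)
    then show ?case
      using g homeomorphic_imp_open_map[of X X g] by (auto simp: open_map_def intro!: openin_sets)
  next
    case (Compl A)
    then have "A \<subseteq> topspace X"
      by (metis sets_eq sets.sets_into_space space_eq)
    then have "g ` (topspace X - A) = space \<mu> - g ` A"
      using inj onto by (simp add: inj_on_image_set_diff space_eq)
    then show ?case using Compl by auto
  next
    case (Union A)
    then show ?case by (auto simp: image_UN)
  qed simp
qed

lemma emeasure_image_measure:
  assumes g: "homeomorphic_map X X g" and A: "A \<in> sets \<mu>"
  shows "emeasure (measure_of (space \<mu>) (sets \<mu>) (\<lambda>A. emeasure \<mu> (g ` A))) A = emeasure \<mu> (g ` A)"
proof (rule emeasure_measure_of_sigma[OF sets.sigma_algebra_axioms _ _ A])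
  show "positive (sets \<mu>) (\<lambda>A. emeasure \<mu> (g ` A))" by (simp add: positive_def)
  show "countably_additive (sets \<mu>) (\<lambda>A. emeasure \<mu> (g ` A))"
  proof (rule countably_additiveI)
    fix B :: "nat \<Rightarrow> 'a set"
    assume B: "range B \<subseteq> sets \<mu>" "disjoint_family B"
    have inj: "inj_on g (topspace X)" using g by (auto simp: homeomorphic_eq_everything_map)
    have "disjoint_family (\<lambda>i. g ` B i)"
      unfolding disjoint_family_on_def
    proof (intro ballI impI)
      fix i j :: nat assume "i \<noteq> j"
      then have "B i \<inter> B j = {}" using B by (auto simp: disjoint_family_on_def)
      moreover have "B i \<subseteq> topspace X" "B j \<subseteq> topspace X"
        using B sets.sets_into_space space_eq by (metis range_subsetD)+
      ultimately show "g ` B i \<inter> g ` B j = {}"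
        using inj_on_image_Int[OF inj, of "B i" "B j"] by auto
    qed
    moreover have "range (\<lambda>i. g ` B i) \<subseteq> sets \<mu>"
      using B homeomorphic_image_sets[OF g] by auto
    ultimately show "(\<Sum>i. emeasure \<mu> (g ` B i)) = emeasure \<mu> (g ` (\<Union>i. B i))"
      by (simp add: suminf_emeasure image_UN)
  qed
qed

lemma H_bac_iff:
  "g \<in> carrier (H_bac X \<mu>) \<longleftrightarrow> g \<in> extensional (topspace X) \<and> homeomorphic_map X X g \<and>
     (\<forall>A\<in>sets \<mu>. emeasure \<mu> A = 0 \<longleftrightarrow> emeasure \<mu> (g ` A) = 0)"
  by (auto simp: H_bac_def homeo_group_def)

lemma H_bac_homeomorphic: "g \<in> carrier (H_bac X \<mu>) \<Longrightarrow> homeomorphic_map X X g"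
  by (simp add: H_bac_iff)

lemma one_H_bac: "\<one>\<^bsub>H_bac X \<mu>\<^esub> = (\<lambda>x\<in>topspace X. x)"
  by (simp add: H_bac_def homeo_group_def)

lemma image_one: "A \<subseteq> topspace X \<Longrightarrow> \<one>\<^bsub>H_bac X \<mu>\<^esub> ` A = A"
  by (force simp: one_H_bac)

lemma one_in_H_bac: "\<one>\<^bsub>H_bac X \<mu>\<^esub> \<in> carrier (H_bac X \<mu>)"
proof -
  have "homeomorphic_map X X \<one>\<^bsub>H_bac X \<mu>\<^esub>"
    by (rule homeomorphic_map_eq[of X X id]) (auto simp: one_H_bac)
  moreover have "\<one>\<^bsub>H_bac X \<mu>\<^esub> ` A = A" if "A \<in> sets \<mu>" for A
    using that sets.sets_into_space[of A \<mu>] by (simp add: image_one space_eq)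
  ultimately show ?thesis
    by (simp add: H_bac_iff) (simp add: one_H_bac)
qed

lemma mult_H_bac: "v \<otimes>\<^bsub>H_bac X \<mu>\<^esub> w = compose (topspace X) v w"
  by (simp add: H_bac_def homeo_group_def)

lemma RN_derivative_H_bac:
  assumes g: "g \<in> carrier (H_bac X \<mu>)"
  shows integrable_RN_derivative: "integrable \<mu> (RN_derivative \<mu> g)"
    and integral_RN_derivative:
      "A \<in> sets \<mu> \<Longrightarrow> (\<integral>x. indicator A x * RN_derivative \<mu> g x \<partial>\<mu>) = measure \<mu> (g ` A)"
proof -
  define N where "N = measure_of (space \<mu>) (sets \<mu>) (\<lambda>A. emeasure \<mu> (g ` A))"
  have hom: "homeomorphic_map X X g" using g by (rule H_bac_homeomorphic)
  have N: "emeasure N A = emeasure \<mu> (g ` A)" if "A \<in> sets \<mu>" for A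
    unfolding N_def by (rule emeasure_image_measure[OF hom that])
  have setsN: "sets N = sets \<mu>" and spaceN: "space N = space \<mu>"
    unfolding N_def by (auto simp: sets.sets_into_space)
  have ac: "absolutely_continuous \<mu> N"
    unfolding absolutely_continuous_def
  proof
    fix A assume "A \<in> null_sets \<mu>"
    then have "A \<in> sets \<mu>" "emeasure \<mu> A = 0" by auto
    moreover from this have "emeasure \<mu> (g ` A) = 0" using g unfolding H_bac_iff by blast
    ultimately show "A \<in> null_sets N" by (simp add: null_sets_def setsN N)
  qed
  have fin: "finite_measure N"
    by (rule finite_measureI) (simp add: spaceN N)
  have dens: "density \<mu> (RN_deriv \<mu> N) = N" by (rule density_RN_deriv[OF ac setsN])
  have finAE: "AE x in \<mu>. RN_deriv \<mu> N x \<noteq> \<infinity>"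
    by (rule RN_deriv_finite[OF finite_measure.axioms(1)[OF fin] ac setsN])
  have RN: "RN_derivative \<mu> g x = enn2real (RN_deriv \<mu> N x)" for x
    by (simp add: RN_derivative_def N_def)
  have meas [measurable]: "RN_derivative \<mu> g \<in> borel_measurable \<mu>"
    unfolding RN[abs_def] by measurable
  have nn: "(\<integral>\<^sup>+x. ennreal (indicator A x * RN_derivative \<mu> g x) \<partial>\<mu>) = emeasure \<mu> (g ` A)"
    if A: "A \<in> sets \<mu>" for A
  proof -
    have "(\<integral>\<^sup>+x. ennreal (indicator A x * RN_derivative \<mu> g x) \<partial>\<mu>) =
        (\<integral>\<^sup>+x. RN_deriv \<mu> N x * indicator A x \<partial>\<mu>)"
      by (rule nn_integral_cong_AE, use finAE in eventually_elim)
        (auto simp: RN indicator_def less_top[symmetric])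
    also have "\<dots> = emeasure N A"
      using A by (subst dens[symmetric]) (simp add: emeasure_density)
    finally show ?thesis by (simp add: N A)
  qed
  show int: "integrable \<mu> (RN_derivative \<mu> g)"
  proof (rule integrableI_nonneg)
    have "(\<integral>\<^sup>+x. ennreal (RN_derivative \<mu> g x) \<partial>\<mu>) =
      (\<integral>\<^sup>+x. ennreal (indicator (space \<mu>) x * RN_derivative \<mu> g x) \<partial>\<mu>)"
      by (rule nn_integral_cong) simp
    then show "(\<integral>\<^sup>+x. ennreal (RN_derivative \<mu> g x) \<partial>\<mu>) < \<infinity>"
      by (simp add: nn less_top[symmetric])
  qed (auto simp: RN)
  show "(\<integral>x. indicator A x * RN_derivative \<mu> g x \<partial>\<mu>) = measure \<mu> (g ` A)" if A: "A \<in> sets \<mu>"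
  proof -
    have "(\<integral>x. indicator A x * RN_derivative \<mu> g x \<partial>\<mu>) =
        enn2real (\<integral>\<^sup>+x. ennreal (indicator A x * RN_derivative \<mu> g x) \<partial>\<mu>)"
      using A by (intro integral_eq_nn_integral) (auto simp: RN)
    then show ?thesis by (simp add: nn[OF A] measure_def)
  qed
qed

lemma rho_ac_self: "rho_ac \<mu> g g = 0"
  by (simp add: rho_ac_def)

lemma rho_ac_triangle:
  assumes "f \<in> carrier (H_bac X \<mu>)" "g \<in> carrier (H_bac X \<mu>)" "h \<in> carrier (H_bac X \<mu>)"
  shows "rho_ac \<mu> f h \<le> rho_ac \<mu> f g + rho_ac \<mu> g h"
proof -
  note [simp] = assms[THEN integrable_RN_derivative]
  have "rho_ac \<mu> f h \<le> (\<integral>x. \<bar>RN_derivative \<mu> f x - RN_derivative \<mu> g x\<bar> +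
      \<bar>RN_derivative \<mu> g x - RN_derivative \<mu> h x\<bar> \<partial>\<mu>)"
    unfolding rho_ac_def by (rule integral_mono) auto
  also have "\<dots> = rho_ac \<mu> f g + rho_ac \<mu> g h"
    unfolding rho_ac_def by (rule Bochner_Integration.integral_add) auto
  finally show ?thesis .
qed

text \<open>
Both densities integrate to the total mass of \<open>\<mu>\<close>, so the integrals of their difference over \<open>A\<close>
and over the complement of \<open>A\<close> are opposite. Taking \<open>A\<close> to be the set where the difference is
nonnegative turns the right-hand side into the \<open>L\<^sup>1\<close>-distance; no other choice of \<open>A\<close> gives a
larger value.
\<close>
lemma twice_measure_diff_eq_integral:
  assumes g: "g \<in> carrier (H_bac X \<mu>)" and A: "A \<in> sets \<mu>"
  shows "2 * (measure \<mu> (g ` A) - measure \<mu> A) =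
    (\<integral>x. (2 * indicator A x - 1) *
       (RN_derivative \<mu> g x - RN_derivative \<mu> \<one>\<^bsub>H_bac X \<mu>\<^esub> x) \<partial>\<mu>)"
proof -
  note [simp] = integrable_RN_derivative[OF g] integrable_RN_derivative[OF one_in_H_bac]
  have hom: "homeomorphic_map X X g" using g by (rule H_bac_homeomorphic)
  have ind: "integrable \<mu> (\<lambda>x. indicator A x * RN_derivative \<mu> h x)"
    if "h \<in> carrier (H_bac X \<mu>)" for h
    using integrable_RN_derivative[OF that] A by (simp add: integrable_mult_indicator[where 'b=real, simplified])
  have tot: "(\<integral>x. RN_derivative \<mu> h x \<partial>\<mu>) = measure \<mu> (space \<mu>)"
    if h: "h \<in> carrier (H_bac X \<mu>)" for h
  proof -
    have "(\<integral>x. RN_derivative \<mu> h x \<partial>\<mu>) = (\<integral>x. indicator (space \<mu>) x * RN_derivative \<mu> h x \<partial>\<mu>)"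
      by (rule Bochner_Integration.integral_cong) auto
    also have "\<dots> = measure \<mu> (h ` space \<mu>)" by (rule integral_RN_derivative[OF h]) simp
    finally show ?thesis
      using H_bac_homeomorphic[OF h] by (simp add: space_eq homeomorphic_eq_everything_map)
  qed
  have "A \<subseteq> topspace X" using A sets.sets_into_space space_eq by metis
  then have one: "(\<integral>x. indicator A x * RN_derivative \<mu> \<one>\<^bsub>H_bac X \<mu>\<^esub> x \<partial>\<mu>) = measure \<mu> A"
    using integral_RN_derivative[OF one_in_H_bac A] by (simp add: image_one)
  have "(\<integral>x. (2 * indicator A x - 1) *
       (RN_derivative \<mu> g x - RN_derivative \<mu> \<one>\<^bsub>H_bac X \<mu>\<^esub> x) \<partial>\<mu>) =
     (\<integral>x. 2 * (indicator A x * RN_derivative \<mu> g x) -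
        2 * (indicator A x * RN_derivative \<mu> \<one>\<^bsub>H_bac X \<mu>\<^esub> x) -
        (RN_derivative \<mu> g x - RN_derivative \<mu> \<one>\<^bsub>H_bac X \<mu>\<^esub> x) \<partial>\<mu>)"
    by (rule Bochner_Integration.integral_cong) (auto simp: algebra_simps)
  also have "\<dots> = 2 * (measure \<mu> (g ` A) - measure \<mu> A)"
    using ind[OF g] ind[OF one_in_H_bac] integral_RN_derivative[OF g A] one tot[OF g] tot[OF one_in_H_bac]
    by simp
  finally show ?thesis by simp
qed

lemma measure_image_diff_le_rho_ac:
  assumes g: "g \<in> carrier (H_bac X \<mu>)" and A: "A \<in> sets \<mu>"
  shows "\<bar>measure \<mu> (g ` A) - measure \<mu> A\<bar> \<le> rho_ac \<mu> \<one>\<^bsub>H_bac X \<mu>\<^esub> g / 2"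
proof -
  let ?f = "\<lambda>x. RN_derivative \<mu> g x - RN_derivative \<mu> \<one>\<^bsub>H_bac X \<mu>\<^esub> x"
  have "\<bar>2 * (measure \<mu> (g ` A) - measure \<mu> A)\<bar> \<le> (\<integral>x. \<bar>(2 * indicator A x - 1) * ?f x\<bar> \<partial>\<mu>)"
    unfolding twice_measure_diff_eq_integral[OF assms] by (rule integral_abs_bound)
  also have "\<dots> = rho_ac \<mu> \<one>\<^bsub>H_bac X \<mu>\<^esub> g"
    unfolding rho_ac_def by (rule Bochner_Integration.integral_cong) (auto simp: indicator_def)
  finally show ?thesis by (simp add: abs_mult del: right_diff_distrib_numeral)
qed

lemma rho_ac_eq_measure_image_diff:
  assumes g: "g \<in> carrier (H_bac X \<mu>)"
  obtains P where "P \<in> sets \<mu>" "rho_ac \<mu> \<one>\<^bsub>H_bac X \<mu>\<^esub> g = 2 * (measure \<mu> (g ` P) - measure \<mu> P)"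
proof
  note [measurable] = borel_measurable_integrable[OF integrable_RN_derivative[OF g]]
    borel_measurable_integrable[OF integrable_RN_derivative[OF one_in_H_bac]]
  let ?f = "\<lambda>x. RN_derivative \<mu> g x - RN_derivative \<mu> \<one>\<^bsub>H_bac X \<mu>\<^esub> x"
  let ?P = "{x\<in>space \<mu>. 0 \<le> ?f x}"
  show P: "?P \<in> sets \<mu>" by measurable
  show "rho_ac \<mu> \<one>\<^bsub>H_bac X \<mu>\<^esub> g = 2 * (measure \<mu> (g ` ?P) - measure \<mu> ?P)"
    unfolding twice_measure_diff_eq_integral[OF g P] rho_ac_def
    by (rule Bochner_Integration.integral_cong) (auto simp: indicator_def)
qed

section \<open>Convergence to the identity\<close>

lemma openin_tau_ac_rho_ball:
  assumes "0 < d"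
  shows "openin (tau_ac X \<mu>) {v \<in> carrier (H_bac X \<mu>). rho_ac \<mu> \<one>\<^bsub>H_bac X \<mu>\<^esub> v < d}"
proof -
  have "openin (pseudometric_topology (carrier (H_bac X \<mu>)) (rho_ac \<mu>))
      {v \<in> carrier (H_bac X \<mu>). rho_ac \<mu> \<one>\<^bsub>H_bac X \<mu>\<^esub> v < d}"
    unfolding pseudometric_topology_def
    by (rule topology_generated_by_Basis) (use assms one_in_H_bac in blast)
  then show ?thesis unfolding tau_ac_def by (intro topology_generated_by_Basis) blast
qed

text \<open>
The balls generating the topology of \<^const>\<open>rho_ac\<close> have arbitrary centres; the triangle inequality
reduces them to balls around the identity.
\<close>
lemma limitin_tau_ac_one_iff:
  assumes g: "\<And>n. g n \<in> carrier (H_bac X \<mu>)"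
  shows "limitin (tau_ac X \<mu>) g \<one>\<^bsub>H_bac X \<mu>\<^esub> F \<longleftrightarrow>
    limitin (tau_co X \<mu>) g \<one>\<^bsub>H_bac X \<mu>\<^esub> F \<and>
    (\<forall>d>0. \<forall>\<^sub>F n in F. rho_ac \<mu> \<one>\<^bsub>H_bac X \<mu>\<^esub> (g n) < d)"
    (is "?ac \<longleftrightarrow> ?co \<and> ?rho")
proof -
  let ?e = "\<one>\<^bsub>H_bac X \<mu>\<^esub>" and ?G = "carrier (H_bac X \<mu>)"
  let ?T = "pseudometric_topology ?G (rho_ac \<mu>)"
  have e_co: "?e \<in> topspace (tau_co X \<mu>)"
  proof -
    let ?W = "{f. f \<in> extensional (topspace X) \<and> continuous_map X X f \<and> f ` {} \<subseteq> topspace X}"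
    have "?e \<in> ?W" using one_in_H_bac by (auto simp: H_bac_iff homeomorphic_imp_continuous_map)
    moreover have "?W \<in> {{f. f \<in> extensional (topspace X) \<and> continuous_map X X f \<and> f ` K \<subseteq> U} | K U.
        compactin X K \<and> openin X U}"
      by blast
    ultimately show ?thesis using one_in_H_bac
      unfolding tau_co_def compact_open_topology_def topspace_subtopology topology_generated_by_topspace
      by blast
  qed
  have "?e \<in> {y \<in> ?G. rho_ac \<mu> ?e y < 1}" using one_in_H_bac by (simp add: rho_ac_self)
  then have e_rho: "?e \<in> \<Union>{{y \<in> ?G. rho_ac \<mu> x y < r} |x r. x \<in> ?G \<and> 0 < r}"
    using one_in_H_bac zero_less_one by blast
  have "limitin ?T g ?e F \<longleftrightarrow> ?rho"
  proof
    assume lim: "limitin ?T g ?e F"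
    show ?rho
    proof (intro allI impI)
      fix d :: real assume d: "0 < d"
      then have "openin ?T {v \<in> ?G. rho_ac \<mu> ?e v < d}"
        unfolding pseudometric_topology_def
        by (intro topology_generated_by_Basis) (use one_in_H_bac in blast)
      then have "\<forall>\<^sub>F n in F. g n \<in> {v \<in> ?G. rho_ac \<mu> ?e v < d}"
        using lim d one_in_H_bac rho_ac_self unfolding limitin_def by auto
      then show "\<forall>\<^sub>F n in F. rho_ac \<mu> ?e (g n) < d" by (rule eventually_mono) simp
    qed
  next
    assume *: ?rho
    show "limitin ?T g ?e F"
      unfolding pseudometric_topology_def limitin_topology_generated_by
    proof (intro conjI ballI impI e_rho)
      fix U assume "U \<in> {{y \<in> ?G. rho_ac \<mu> x y < r} |x r. x \<in> ?G \<and> 0 < r}" "?e \<in> U"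
      then obtain x r where U: "U = {y \<in> ?G. rho_ac \<mu> x y < r}" and x: "x \<in> ?G" "rho_ac \<mu> x ?e < r"
        by blast
      then have "\<forall>\<^sub>F n in F. rho_ac \<mu> ?e (g n) < r - rho_ac \<mu> x ?e" using * by simp
      then show "\<forall>\<^sub>F n in F. g n \<in> U"
      proof (rule eventually_mono)
        fix n assume "rho_ac \<mu> ?e (g n) < r - rho_ac \<mu> x ?e"
        then show "g n \<in> U"
          using rho_ac_triangle[OF x(1) one_in_H_bac g[of n]] g[of n] unfolding U by simp
      qed
    qed
  qed
  moreover have "?e \<in> topspace ?T"
    unfolding pseudometric_topology_def topology_generated_by_topspace by (rule e_rho)
  ultimately show ?thesis
    unfolding tau_ac_def using e_co by (simp add: limitin_topology_generated_by_Un)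
qed

end

section \<open>Approximation by sets with finite frontier\<close>

lemma finite_frontier_of_Un:
  assumes "finite (X frontier_of S)" "finite (X frontier_of T)"
  shows "finite (X frontier_of (S \<union> T))"
proof -
  have "X frontier_of (S \<union> T) = X frontier_of ((topspace X - S) \<inter> (topspace X - T))"
    by (metis Diff_Un frontier_of_complement)
  also have "\<dots> \<subseteq> X frontier_of S \<union> X frontier_of T"
    using frontier_of_Int_subset[of X "topspace X - S" "topspace X - T"]
    by (simp add: frontier_of_complement)
  finally show ?thesis using assms finite_subset by blast
qed

lemma finite_frontier_of_UN:
  assumes "finite I" "\<And>i. i \<in> I \<Longrightarrow> finite (X frontier_of (B i))"
  shows "finite (X frontier_of (\<Union>i\<in>I. B i))"
  using assms by (induction I rule: finite_induct) (auto intro: finite_frontier_of_Un)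

text \<open>
What the argument uses of a one-dimensional Oxtoby--Ulam pair: connected open sets with finite
frontier form a base, and points are null.
\<close>
locale finite_frontier_base_measure = finite_borel_measure_on +
  assumes compact: "compact_space X" and Hausdorff: "Hausdorff_space X"
    and second_countable: "second_countable X"
    and base: "openin X U \<Longrightarrow> x \<in> U \<Longrightarrow>
      \<exists>W. openin X W \<and> x \<in> W \<and> W \<subseteq> U \<and> connectedin X W \<and> finite (X frontier_of W)"
    and null_singleton: "x \<in> topspace X \<Longrightarrow> {x} \<in> null_sets \<mu>"
begin

text \<open>
The sets that can be approximated form a \<open>\<sigma>\<close>-algebra. An open set is a countable union of base sets,
because every subspace of \<open>X\<close> is Lindelof. Approximation with respect to two measures at the same
time is needed later for \<open>\<mu>\<close> and \<open>A \<mapsto> \<mu>(h(A))\<close>.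
\<close>
lemma approximation_by_finite_frontier:
  assumes A: "A \<in> sets \<mu>" and N: "finite_measure N" "sets N = sets \<mu>" and e: "0 < (e::real)"
  shows "\<exists>B\<in>sets \<mu>. finite (X frontier_of B) \<and>
    measure \<mu> ((A - B) \<union> (B - A)) + measure N ((A - B) \<union> (B - A)) < e"
proof -
  interpret N: finite_measure N by fact
  \<comment> \<open>Size with respect to both measures; it is monotone, subadditive and continuous on decreasing sequences.\<close>
  define q where "q S = measure \<mu> S + measure N S" for S
  have q_mono: "q S \<le> q T" if "S \<subseteq> T" "T \<in> sets \<mu>" for S T
    unfolding q_def using that N(2) by (intro add_mono finite_measure_mono N.finite_measure_mono) auto
  have q_Un: "q (S \<union> T) \<le> q S + q T" if "S \<in> sets \<mu>" "T \<in> sets \<mu>" for S T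
    unfolding q_def using measure_Un_le[OF that] measure_Un_le[of S N T] that N(2)
    by simp
  have q_UN: "q (\<Union>i\<in>I. S i) \<le> (\<Sum>i\<in>I. q (S i))" if "finite I" "\<And>i. i \<in> I \<Longrightarrow> S i \<in> sets \<mu>"
    for I :: "nat set" and S
    using that
  proof (induction I rule: finite_induct)
    case (insert i I)
    have "q (\<Union>i\<in>insert i I. S i) \<le> q (S i) + q (\<Union>i\<in>I. S i)"
      using insert by (simp add: q_Un sets.finite_UN)
    then show ?case using insert by auto
  qed (simp add: q_def)
  define appr where "appr A \<longleftrightarrow> (\<forall>e>0. \<exists>B\<in>sets \<mu>. finite (X frontier_of B) \<and>
    q ((A - B) \<union> (B - A)) < e)" for A
  have UN: "appr (\<Union>i. A i)" if A: "\<And>i::nat. A i \<in> sets \<mu>" "\<And>i. appr (A i)" for A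
    unfolding appr_def
  proof (intro allI impI)
    fix e :: real assume e: "0 < e"
    define D where "D k = (\<Union>i. A i) - (\<Union>i<k. A i)" for k
    have D: "D k \<in> sets \<mu>" for k unfolding D_def using A by auto
    have dec: "decseq D" unfolding D_def decseq_def by fastforce
    have D0: "(\<Inter>k. D k) = {}" unfolding D_def by auto
    have "(\<lambda>k. measure \<mu> (D k)) \<longlonglongrightarrow> 0" "(\<lambda>k. measure N (D k)) \<longlonglongrightarrow> 0"
      using finite_Lim_measure_decseq[of D] N.finite_Lim_measure_decseq[of D] D dec D0 N(2)
      by (simp_all add: image_subset_iff)
    then have "(\<lambda>k. q (D k)) \<longlonglongrightarrow> 0 + 0" unfolding q_def by (intro tendsto_add)
    then have "\<forall>\<^sub>F k in sequentially. q (D k) < e / 2"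
      by (rule order_tendstoD) (use e in auto)
    then obtain k where k: "q (D k) < e / 2" by (auto simp: eventually_sequentially)
    have "0 < e / (2 * (real k + 1))" using e by simp
    then have "\<exists>B. B \<in> sets \<mu> \<and> finite (X frontier_of B) \<and>
      q ((A i - B) \<union> (B - A i)) < e / (2 * (real k + 1))" for i
      using A(2)[of i] unfolding appr_def by blast
    then obtain B where B: "\<And>i. B i \<in> sets \<mu>" "\<And>i. finite (X frontier_of (B i))"
      "\<And>i. q ((A i - B i) \<union> (B i - A i)) < e / (2 * (real k + 1))" by metis
    let ?B = "\<Union>i<k. B i"
    have sub: "((\<Union>i. A i) - ?B) \<union> (?B - (\<Union>i. A i)) \<subseteq>
        D k \<union> (\<Union>i<k. (A i - B i) \<union> (B i - A i))"
      unfolding D_def by auto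
    have "q (((\<Union>i. A i) - ?B) \<union> (?B - (\<Union>i. A i))) \<le> q (D k \<union> (\<Union>i<k. (A i - B i) \<union> (B i - A i)))"
      by (rule q_mono[OF sub]) (use A B D in auto)
    also have "\<dots> \<le> q (D k) + q (\<Union>i<k. (A i - B i) \<union> (B i - A i))"
      by (rule q_Un) (use A B D in auto)
    also have "q (\<Union>i<k. (A i - B i) \<union> (B i - A i)) \<le> (\<Sum>i<k. q ((A i - B i) \<union> (B i - A i)))"
      by (rule q_UN) (use A B in auto)
    also have "\<dots> \<le> (\<Sum>i<k. e / (2 * (real k + 1)))"
      by (rule sum_mono) (use B(3) less_imp_le in blast)
    also have "\<dots> \<le> e / 2" using e by (simp add: field_simps)
    finally have "q (((\<Union>i. A i) - ?B) \<union> (?B - (\<Union>i. A i))) < e" using k by simp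
    moreover have "finite (X frontier_of ?B)" by (rule finite_frontier_of_UN) (use B in auto)
    moreover have "?B \<in> sets \<mu>" using B by auto
    ultimately show "\<exists>B\<in>sets \<mu>. finite (X frontier_of B) \<and>
      q (((\<Union>i. A i) - B) \<union> (B - (\<Union>i. A i))) < e" by blast
  qed
  have self: "appr B" if "B \<in> sets \<mu>" "finite (X frontier_of B)" for B
    unfolding appr_def by (intro allI impI bexI[of _ B]) (use that in \<open>auto simp: q_def\<close>)
  have "A \<in> sigma_sets (topspace X) {U. openin X U}" using A sets_eq by simp
  then have "appr A"
  proof (induction rule: sigma_sets.induct)
    case Empty
    show ?case by (rule self) auto
  next
    case (Basic U)
    then have U: "openin X U" by simp
    let ?W = "{W. openin X W \<and> W \<subseteq> U \<and> finite (X frontier_of W)}"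
    have "Lindelof_space (subtopology X U)"
      using second_countable second_countable_subtopology second_countable_imp_Lindelof_space by blast
    moreover have "\<Union>?W = topspace (subtopology X U)"
    proof -
      have "\<Union>?W = U"
      proof
        show "U \<subseteq> \<Union>?W"
        proof
          fix x assume "x \<in> U"
          from base[OF U this] show "x \<in> \<Union>?W" by blast
        qed
      qed blast
      then show ?thesis using openin_subset[OF U] by auto
    qed
    ultimately obtain V where V: "countable V" "V \<subseteq> ?W" "\<Union>V = topspace (subtopology X U)"
      using Lindelof_spaceD[of "subtopology X U" ?W] U by (auto simp: openin_open_subtopology)
    have VU: "\<Union>V = U" using V(3) openin_subset[OF U] by auto
    show ?case
    proof (cases "V = {}")
      case True
      then show ?thesis using VU self[of "{}"] by auto
    next
      case False
      have "from_nat_into V i \<in> ?W" for i using from_nat_into[OF False] V by blast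
      then have "appr (\<Union>i. from_nat_into V i)"
        by (intro UN self) (auto intro: openin_sets)
      moreover have "(\<Union>i. from_nat_into V i) = U" using range_from_nat_into[OF False V(1)] VU by simp
      ultimately show ?thesis by simp
    qed
  next
    case (Compl A)
    show ?case unfolding appr_def
    proof (intro allI impI)
      fix e :: real assume "0 < e"
      then obtain B where B: "B \<in> sets \<mu>" "finite (X frontier_of B)" "q ((A - B) \<union> (B - A)) < e"
        using Compl.IH unfolding appr_def by blast
      have "A \<subseteq> topspace X" "B \<subseteq> topspace X"
        using B(1) Compl.hyps by (metis sets_eq sets.sets_into_space space_eq)+
      then have "((topspace X - A) - (topspace X - B)) \<union> ((topspace X - B) - (topspace X - A)) =
          (A - B) \<union> (B - A)" by auto
      moreover have "topspace X - B \<in> sets \<mu>" using B sets.compl_sets space_eq by metis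
      ultimately show "\<exists>B\<in>sets \<mu>. finite (X frontier_of B) \<and>
          q ((topspace X - A - B) \<union> (B - (topspace X - A))) < e"
        using B by (intro bexI[of _ "topspace X - B"]) (auto simp: frontier_of_complement)
    qed
  next
    case (Union A)
    then show ?case by (intro UN) (auto simp: sets_eq)
  qed
  then show ?thesis using e unfolding appr_def q_def by blast
qed

section \<open>Uniform limits and sets with finite frontier\<close>

lemma small_open_neighbourhood:
  assumes p: "p \<in> topspace X" and e: "0 < e"
  shows "\<exists>U. openin X U \<and> p \<in> U \<and> measure \<mu> U < e"
proof -
  obtain \<B> where \<B>: "countable \<B>" "\<And>V. V \<in> \<B> \<Longrightarrow> openin X V"
    "\<And>U x. openin X U \<Longrightarrow> x \<in> U \<Longrightarrow> \<exists>V\<in>\<B>. x \<in> V \<and> V \<subseteq> U"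
    using second_countable unfolding second_countable_def by meson
  define C where "C = {U \<in> \<B>. p \<in> U}"
  have C: "countable C" "C \<noteq> {}"
    unfolding C_def using \<B>(1) \<B>(3)[OF openin_topspace p] by auto
  \<comment> \<open>Finite intersections of basic neighbourhoods of \<open>p\<close> decrease to the null set \<open>{p}\<close>.\<close>
  define A where "A n = (\<Inter>i\<le>n. from_nat_into C i)" for n :: nat
  have memC: "from_nat_into C i \<in> C" for i by (rule from_nat_into[OF C(2)])
  then have op: "openin X (A n)" for n
    unfolding A_def using \<B>(2) by (intro openin_Inter) (auto simp: C_def)
  have pA: "p \<in> A n" for n unfolding A_def using memC by (auto simp: C_def)
  have dec: "decseq A" unfolding A_def decseq_def by fastforce
  have "(\<Inter>n. A n) = {p}"
  proof (intro equalityI subsetI)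
    fix x assume x: "x \<in> (\<Inter>n. A n)"
    show "x \<in> {p}"
    proof (rule ccontr)
      assume "x \<notin> {p}"
      then have "x \<noteq> p" by simp
      moreover have "x \<in> topspace X" using x op[of 0] openin_subset by auto
      ultimately obtain U V where UV: "openin X U" "p \<in> U" "x \<in> V" "disjnt U V"
        using Hausdorff p unfolding Hausdorff_space_def by metis
      then obtain W where W: "W \<in> \<B>" "p \<in> W" "W \<subseteq> U" using \<B>(3) by blast
      then have "W \<in> C" by (simp add: C_def)
      then obtain i where "from_nat_into C i = W" using from_nat_into_surj[OF C(1)] by blast
      then have "x \<in> W" using x unfolding A_def by auto
      then show False using W UV by (auto simp: disjnt_def)
    qed
  qed (use pA in auto)
  moreover have "(\<lambda>n. measure \<mu> (A n)) \<longlonglongrightarrow> measure \<mu> (\<Inter>n. A n)"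
    by (rule finite_Lim_measure_decseq) (use dec op openin_sets in auto)
  moreover have "measure \<mu> {p} = 0" using null_singleton[OF p] by (simp add: measure_def null_setsD1)
  ultimately have "(\<lambda>n. measure \<mu> (A n)) \<longlonglongrightarrow> 0" by simp
  then have "\<forall>\<^sub>F n in sequentially. measure \<mu> (A n) < e"
    by (rule order_tendstoD) (use e in auto)
  then show ?thesis using op pA by (auto simp: eventually_sequentially)
qed

text \<open>
A compact Hausdorff space is regular, so every neighbourhood assignment can be shrunk to closed
neighbourhoods before a finite subcover is chosen.
\<close>
lemma finite_shrinking:
  assumes N: "\<And>p. p \<in> topspace X \<Longrightarrow> openin X (N p) \<and> p \<in> N p"
  shows "\<exists>I M K. finite I \<and> I \<subseteq> topspace X \<and> topspace X \<subseteq> (\<Union>p\<in>I. M p) \<and>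
    (\<forall>p\<in>topspace X. openin X (M p) \<and> closedin X (K p) \<and> p \<in> M p \<and> M p \<subseteq> K p \<and> K p \<subseteq> N p)"
proof -
  have nb: "neighbourhood_base_of (closedin X) X"
    using compact Hausdorff compact_Hausdorff_imp_regular_space neighbourhood_base_of_closedin by blast
  have "\<forall>p\<in>topspace X. \<exists>U V. openin X U \<and> closedin X V \<and> p \<in> U \<and> U \<subseteq> V \<and> V \<subseteq> N p"
    using nb N unfolding neighbourhood_base_of by blast
  then obtain M where "\<forall>p\<in>topspace X. \<exists>V. openin X (M p) \<and> closedin X V \<and> p \<in> M p \<and> M p \<subseteq> V \<and> V \<subseteq> N p"
    by (rule bchoice[THEN exE]) 
  then obtain K where MK: "\<forall>p\<in>topspace X. openin X (M p) \<and> closedin X (K p) \<and> p \<in> M p \<and> M p \<subseteq> K p \<and> K p \<subseteq> N p"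
    by (rule bchoice[THEN exE])
  have "\<exists>\<F>. finite \<F> \<and> \<F> \<subseteq> M ` topspace X \<and> topspace X \<subseteq> \<Union>\<F>"
    using compact unfolding compact_space_alt
  proof (elim allE[of _ "M ` topspace X"] impE)
    show "(\<forall>U\<in>M ` topspace X. openin X U) \<and> topspace X \<subseteq> \<Union> (M ` topspace X)"
      using MK by blast
  qed
  then obtain I where "finite I" "I \<subseteq> topspace X" "topspace X \<subseteq> (\<Union>p\<in>I. M p)"
    using finite_subset_image by metis
  then show ?thesis using MK by blast
qed

text \<open>
A pointwise star refinement of a cover by sets of small measure: all members of the cover through a
given point lie together in one set of small measure. Choose a finite subcover of shrunken sets
\<open>M\<^sub>i \<subseteq> K\<^sub>i \<subseteq> N\<^sub>i\<close> with \<open>K\<^sub>i\<close> closed. Let \<open>Q\<^sub>x\<close> be the intersection of the \<open>N\<^sub>i\<close> with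
\<open>x \<in> K\<^sub>i\<close> and of the complements of the remaining \<open>K\<^sub>i\<close>. If \<open>p \<in> M\<^sub>i\<close> lies in \<open>Q\<^sub>x\<close>, then \<open>x \<in> K\<^sub>i\<close>,
whence \<open>Q\<^sub>x \<subseteq> N\<^sub>i\<close>.
\<close>
lemma connected_cover_with_small_stars:
  assumes e: "0 < e"
  obtains C S where "\<And>x. x \<in> topspace X \<Longrightarrow> openin X (C x) \<and> x \<in> C x \<and> connectedin X (C x)"
    and "\<And>p. p \<in> topspace X \<Longrightarrow> openin X (S p) \<and> measure \<mu> (S p) < e"
    and "\<And>p x. x \<in> topspace X \<Longrightarrow> p \<in> C x \<Longrightarrow> C x \<subseteq> S p"
proof -
  obtain N where N: "\<And>p. p \<in> topspace X \<Longrightarrow> openin X (N p) \<and> p \<in> N p \<and> measure \<mu> (N p) < e"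
    using small_open_neighbourhood[OF _ e] by metis
  obtain I M K where I: "finite I" "I \<subseteq> topspace X" "topspace X \<subseteq> (\<Union>p\<in>I. M p)"
    and MK: "\<And>p. p \<in> topspace X \<Longrightarrow> openin X (M p) \<and> closedin X (K p) \<and> p \<in> M p \<and> M p \<subseteq> K p \<and> K p \<subseteq> N p"
    using finite_shrinking[of N] N by metis
  define Q where "Q x = topspace X \<inter> (\<Inter>p\<in>{p\<in>I. x \<in> K p}. N p) \<inter> (\<Inter>p\<in>{p\<in>I. x \<notin> K p}. topspace X - K p)" for x
  have Q: "openin X (Q x)" "x \<in> Q x" if "x \<in> topspace X" for x
  proof -
    have op: "openin X (topspace X \<inter> (\<Inter>p\<in>J. G p))" if "finite J" "\<And>p. p \<in> J \<Longrightarrow> openin X (G p)" for J :: "'a set" and G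
      using that
    proof (induction J rule: finite_induct)
      case (insert p J)
      then have "openin X (G p \<inter> (topspace X \<inter> (\<Inter>p\<in>J. G p)))" by (metis insertCI openin_Int)
      moreover have "G p \<inter> (topspace X \<inter> (\<Inter>p\<in>J. G p)) = topspace X \<inter> (\<Inter>p\<in>insert p J. G p)" by blast
      ultimately show ?case by (simp only:)
    qed simp
    have "openin X ((topspace X \<inter> (\<Inter>p\<in>{p\<in>I. x \<in> K p}. N p)) \<inter> (topspace X \<inter> (\<Inter>p\<in>{p\<in>I. x \<notin> K p}. topspace X - K p)))"
    proof (rule openin_Int)
      show "openin X (topspace X \<inter> (\<Inter>p\<in>{p\<in>I. x \<in> K p}. N p))"
        by (rule op) (use I N in auto)
      show "openin X (topspace X \<inter> (\<Inter>p\<in>{p\<in>I. x \<notin> K p}. topspace X - K p))"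
        by (rule op) (use I MK in auto)
    qed
    moreover have "(topspace X \<inter> (\<Inter>p\<in>{p\<in>I. x \<in> K p}. N p)) \<inter> (topspace X \<inter> (\<Inter>p\<in>{p\<in>I. x \<notin> K p}. topspace X - K p)) = Q x"
      unfolding Q_def by blast
    ultimately show "openin X (Q x)" by simp
    show "x \<in> Q x" unfolding Q_def using \<open>x \<in> topspace X\<close> I MK by blast
  qed
  have "\<forall>x\<in>topspace X. \<exists>W. openin X W \<and> x \<in> W \<and> W \<subseteq> Q x \<and> connectedin X W"
    using base[OF Q] by blast
  then obtain C where C: "\<forall>x\<in>topspace X. openin X (C x) \<and> x \<in> C x \<and> C x \<subseteq> Q x \<and> connectedin X (C x)"
    by (rule bchoice[THEN exE])
  have "\<forall>p\<in>topspace X. \<exists>i. i \<in> I \<and> p \<in> M i" using I(3) by blast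
  then obtain j where j: "\<forall>p\<in>topspace X. j p \<in> I \<and> p \<in> M (j p)"
    by (rule bchoice[THEN exE])
  show ?thesis
  proof
    show "openin X (C x) \<and> x \<in> C x \<and> connectedin X (C x)" if "x \<in> topspace X" for x
      using bspec[OF C that] by blast
    show "openin X (N (j p)) \<and> measure \<mu> (N (j p)) < e" if "p \<in> topspace X" for p
      using N bspec[OF j that] I by blast
    fix p x assume x: "x \<in> topspace X" and p: "p \<in> C x"
    have pQ: "p \<in> Q x" using bspec[OF C x] p by blast
    then have pX: "p \<in> topspace X" by (simp add: Q_def)
    have "p \<in> K (j p)" using bspec[OF j pX] MK I by blast
    then have "x \<in> K (j p)" using pQ bspec[OF j pX] unfolding Q_def by blast
    then have "Q x \<subseteq> N (j p)" using bspec[OF j pX] unfolding Q_def by blast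
    then show "C x \<subseteq> N (j p)" using bspec[OF C x] by blast
  qed
qed

lemma tau_co_limit_eventually_image_subset:
  assumes lim: "limitin (tau_co X \<mu>) g \<one>\<^bsub>H_bac X \<mu>\<^esub> F"
    and K: "compactin X K" and U: "openin X U" and KU: "K \<subseteq> U"
  shows "\<forall>\<^sub>F n in F. g n ` K \<subseteq> U"
proof -
  let ?S = "{{f. f \<in> extensional (topspace X) \<and> continuous_map X X f \<and> f ` K \<subseteq> U} | K U.
        compactin X K \<and> openin X U}"
  let ?W = "{f. f \<in> extensional (topspace X) \<and> continuous_map X X f \<and> f ` K \<subseteq> U}"
  have "K \<subseteq> topspace X" using K compactin_subset_topspace by blast
  then have "\<one>\<^bsub>H_bac X \<mu>\<^esub> \<in> ?W"
    using one_in_H_bac KU image_one[of K] by (auto simp: H_bac_iff homeomorphic_imp_continuous_map)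
  moreover have "?W \<in> ?S" using K U by blast
  moreover have "limitin (topology_generated_by ?S) g \<one>\<^bsub>H_bac X \<mu>\<^esub> F"
    using lim unfolding tau_co_def compact_open_topology_def limitin_subtopology by blast
  ultimately have "\<forall>\<^sub>F n in F. g n \<in> ?W"
    unfolding limitin_topology_generated_by by blast
  then show ?thesis by (rule eventually_mono) blast
qed

lemma tau_co_limit_eventually_near:
  assumes lim: "limitin (tau_co X \<mu>) g \<one>\<^bsub>H_bac X \<mu>\<^esub> F"
    and C: "\<And>x. x \<in> topspace X \<Longrightarrow> openin X (C x) \<and> x \<in> C x"
  shows "\<forall>\<^sub>F n in F. \<forall>x\<in>topspace X. \<exists>y\<in>topspace X. x \<in> C y \<and> g n x \<in> C y"
proof -
  obtain I M K where I: "finite I" "I \<subseteq> topspace X" "topspace X \<subseteq> (\<Union>p\<in>I. M p)"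
    and MK: "\<And>p. p \<in> topspace X \<Longrightarrow> openin X (M p) \<and> closedin X (K p) \<and> p \<in> M p \<and> M p \<subseteq> K p \<and> K p \<subseteq> C p"
    using finite_shrinking[of C] C by metis
  have "\<forall>\<^sub>F n in F. \<forall>p\<in>I. g n ` K p \<subseteq> C p"
  proof (rule eventually_ball_finite[OF I(1)], intro ballI)
    fix p assume p: "p \<in> I"
    then have "compactin X (K p)" using MK I compact closedin_compact_space by blast
    then show "\<forall>\<^sub>F n in F. g n ` K p \<subseteq> C p"
      using lim C MK I p by (intro tau_co_limit_eventually_image_subset) blast+
  qed
  then show ?thesis
  proof (rule eventually_mono, intro ballI)
    fix n x assume *: "\<forall>p\<in>I. g n ` K p \<subseteq> C p" and "x \<in> topspace X"
    then obtain p where "p \<in> I" "x \<in> M p" using I by blast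
    then show "\<exists>y\<in>topspace X. x \<in> C y \<and> g n x \<in> C y"
      using * MK I by (intro bexI[of _ p]) blast+
  qed
qed

text \<open>
If \<open>x\<close> and \<open>g(x)\<close> lie in a common connected set and only one of them lies in \<open>B\<close>, then this
connected set meets the frontier of \<open>B\<close>. So \<open>g(B)\<close> and \<open>B\<close> differ only on the stars of the frontier
points of \<open>B\<close>, and the measure of these stars is bounded through their number alone. This uniformity
in \<open>B\<close> is what the proof of non-precompactness rests on.
\<close>
lemma tau_co_limit_measure_image_finite_frontier:
  assumes lim: "limitin (tau_co X \<mu>) g \<one>\<^bsub>H_bac X \<mu>\<^esub> F"
    and g: "\<And>n. g n \<in> carrier (H_bac X \<mu>)" and e: "0 < e"
  shows "\<forall>\<^sub>F n in F. \<forall>B\<in>sets \<mu>. finite (X frontier_of B) \<longrightarrow> card (X frontier_of B) \<le> m \<longrightarrow>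
    \<bar>measure \<mu> (g n ` B) - measure \<mu> B\<bar> \<le> e"
proof -
  have "0 < e / (real m + 1)" using e by simp
  then obtain C S where C: "\<And>x. x \<in> topspace X \<Longrightarrow> openin X (C x) \<and> x \<in> C x \<and> connectedin X (C x)"
    and S: "\<And>p. p \<in> topspace X \<Longrightarrow> openin X (S p) \<and> measure \<mu> (S p) < e / (real m + 1)"
    and CS: "\<And>p x. x \<in> topspace X \<Longrightarrow> p \<in> C x \<Longrightarrow> C x \<subseteq> S p"
    using connected_cover_with_small_stars by metis
  have "\<forall>\<^sub>F n in F. \<forall>x\<in>topspace X. \<exists>y\<in>topspace X. x \<in> C y \<and> g n x \<in> C y"
    by (rule tau_co_limit_eventually_near[OF lim]) (use C in blast)
  then show ?thesis
  proof (rule eventually_mono, intro ballI impI)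
    fix n B
    assume near: "\<forall>x\<in>topspace X. \<exists>y\<in>topspace X. x \<in> C y \<and> g n x \<in> C y"
      and B: "B \<in> sets \<mu>" and fin: "finite (X frontier_of B)" and card: "card (X frontier_of B) \<le> m"
    let ?S = "\<Union>p\<in>X frontier_of B. S p"
    have hom: "homeomorphic_map X X (g n)" using g by (rule H_bac_homeomorphic)
    then have onto: "g n ` topspace X = topspace X" and inj: "inj_on (g n) (topspace X)"
      by (auto simp: homeomorphic_eq_everything_map)
    have BX: "B \<subseteq> topspace X" using B sets.sets_into_space space_eq by metis
    have gB: "g n ` B \<in> sets \<mu>" by (rule homeomorphic_image_sets[OF hom B])
    have frX: "X frontier_of B \<subseteq> topspace X" by (rule frontier_of_subset_topspace)
    have Sset: "?S \<in> sets \<mu>" using fin S frX by (intro sets.finite_UN) (auto intro!: openin_sets)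
    \<comment> \<open>A point and its image on different sides of \<open>B\<close> are near a frontier point of \<open>B\<close>.\<close>
    have meets: "g n x \<in> ?S" if x: "x \<in> topspace X" and "(x \<in> B) \<noteq> (g n x \<in> B)" for x
    proof -
      obtain y where y: "y \<in> topspace X" "x \<in> C y" "g n x \<in> C y" using near x by blast
      have "C y \<inter> X frontier_of B \<noteq> {}"
        by (rule connectedin_Int_frontier_of) (use C[OF y(1)] y that in auto)
      then show ?thesis using CS y by blast
    qed
    have sub1: "g n ` B \<subseteq> B \<union> ?S" using meets BX by blast
    have sub2: "B \<subseteq> g n ` B \<union> ?S"
    proof
      fix y assume y: "y \<in> B"
      then obtain x where "x \<in> topspace X" "y = g n x" using BX onto by blast
      then show "y \<in> g n ` B \<union> ?S" using meets[of x] y by blast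
    qed
    have "measure \<mu> ?S \<le> (\<Sum>p\<in>X frontier_of B. measure \<mu> (S p))"
      using fin S frX by (intro finite_measure_subadditive_finite) (auto intro!: openin_sets)
    also have "\<dots> \<le> (\<Sum>p\<in>X frontier_of B. e / (real m + 1))"
      by (rule sum_mono) (use S frX less_imp_le in blast)
    also have "\<dots> = real (card (X frontier_of B)) * (e / (real m + 1))" by simp
    also have "\<dots> \<le> (real m + 1) * (e / (real m + 1))"
      using card e by (intro mult_right_mono) auto
    also have "\<dots> = e" using e by simp
    finally have Se: "measure \<mu> ?S \<le> e" .
    have "measure \<mu> (g n ` B) \<le> measure \<mu> B + measure \<mu> ?S"
      using finite_measure_mono[OF sub1] measure_Un_le[OF B Sset] B Sset by auto
    moreover have "measure \<mu> B \<le> measure \<mu> (g n ` B) + measure \<mu> ?S"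
      using finite_measure_mono[OF sub2] measure_Un_le[OF gB Sset] gB Sset by auto
    ultimately show "\<bar>measure \<mu> (g n ` B) - measure \<mu> B\<bar> \<le> e" using Se by linarith
  qed
qed

section \<open>Failure of total boundedness\<close>

text \<open>
Approximation with respect to \<open>\<mu>\<close> and \<open>A \<mapsto> \<mu>(h(A))\<close> simultaneously.
\<close>
lemma measure_image_diff_le_if_finite_frontier:
  assumes h: "h \<in> carrier (H_bac X \<mu>)"
    and le: "\<And>B. B \<in> sets \<mu> \<Longrightarrow> finite (X frontier_of B) \<Longrightarrow> \<bar>measure \<mu> (h ` B) - measure \<mu> B\<bar> \<le> c"
    and A: "A \<in> sets \<mu>"
  shows "\<bar>measure \<mu> (h ` A) - measure \<mu> A\<bar> \<le> c"
proof (rule field_le_epsilon)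
  fix e :: real assume e: "0 < e"
  define N where "N = measure_of (space \<mu>) (sets \<mu>) (\<lambda>A. emeasure \<mu> (h ` A))"
  have hom: "homeomorphic_map X X h" using h by (rule H_bac_homeomorphic)
  have N: "emeasure N A = emeasure \<mu> (h ` A)" if "A \<in> sets \<mu>" for A
    unfolding N_def by (rule emeasure_image_measure[OF hom that])
  have setsN: "sets N = sets \<mu>" and spaceN: "space N = space \<mu>"
    unfolding N_def by (auto simp: sets.sets_into_space)
  have fin: "finite_measure N"
    by (rule finite_measureI) (simp add: spaceN N)
  interpret N: finite_measure N by (rule fin)
  obtain B where B: "B \<in> sets \<mu>" "finite (X frontier_of B)"
    "measure \<mu> ((A - B) \<union> (B - A)) + measure N ((A - B) \<union> (B - A)) < e"
    using approximation_by_finite_frontier[OF A fin setsN e] by blast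
  have diff: "\<bar>measure M A - measure M B\<bar> \<le> measure M ((A - B) \<union> (B - A))"
    if "finite_measure M" "sets M = sets \<mu>" for M
  proof -
    interpret M: finite_measure M by fact
    have "measure M A \<le> measure M (B \<union> ((A - B) \<union> (B - A)))"
      "measure M B \<le> measure M (A \<union> ((A - B) \<union> (B - A)))"
      using A B that(2) by (auto intro!: M.finite_measure_mono)
    moreover have "measure M (B \<union> ((A - B) \<union> (B - A))) \<le> measure M B + measure M ((A - B) \<union> (B - A))"
      "measure M (A \<union> ((A - B) \<union> (B - A))) \<le> measure M A + measure M ((A - B) \<union> (B - A))"
      using A B that(2) by (auto intro!: measure_Un_le)
    ultimately show ?thesis by linarith
  qed
  have "measure N S = measure \<mu> (h ` S)" if "S \<in> sets \<mu>" for S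
    using N[OF that] by (simp add: measure_def)
  then show "\<bar>measure \<mu> (h ` A) - measure \<mu> A\<bar> \<le> c + e"
    using diff[OF fin setsN] diff[OF finite_measure_axioms refl] le[OF B(1,2)] B A by simp
qed

text \<open>
By the pigeonhole principle a finite cover would give a fixed \<open>h\<close> with \<open>g\<^sub>n = v\<^sub>n h w\<^sub>n\<close> for
infinitely many \<open>n\<close>. Uniform convergence of \<open>g\<^sub>n\<close> then forces \<open>h\<close>, and with it \<open>g\<^sub>n\<close>, to be close to the
identity in \<^const>\<open>rho_ac\<close>.
\<close>
lemma not_roelcke_totally_bounded_if_tau_co_limit:
  assumes g: "\<And>n. g n \<in> carrier (H_bac X \<mu>)"
    and co: "limitin (tau_co X \<mu>) g \<one>\<^bsub>H_bac X \<mu>\<^esub> sequentially"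
    and ac: "\<not> limitin (tau_ac X \<mu>) g \<one>\<^bsub>H_bac X \<mu>\<^esub> sequentially"
  shows "\<not> roelcke_totally_bounded (H_bac X \<mu>) (tau_ac X \<mu>) (range g)"
proof
  let ?e = "\<one>\<^bsub>H_bac X \<mu>\<^esub>" and ?G = "carrier (H_bac X \<mu>)"
  assume tb: "roelcke_totally_bounded (H_bac X \<mu>) (tau_ac X \<mu>) (range g)"
  obtain r where r: "0 < r" and "\<not> (\<forall>\<^sub>F n in sequentially. rho_ac \<mu> ?e (g n) < r)"
    using ac co g by (auto simp: limitin_tau_ac_one_iff)
  then have far: "\<exists>\<^sub>F n in sequentially. r \<le> rho_ac \<mu> ?e (g n)"
    by (simp add: not_eventually not_less)
  \<comment> \<open>Any radius with \<open>4 d < r\<close> leads to a contradiction below.\<close>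
  define d where "d = r / 5"
  have d: "0 < d" using r by (simp add: d_def)
  define V where "V = {v \<in> ?G. rho_ac \<mu> ?e v < d}"
  have "openin (tau_ac X \<mu>) V" unfolding V_def by (rule openin_tau_ac_rho_ball[OF d])
  moreover have "?e \<in> V" using one_in_H_bac d by (simp add: V_def rho_ac_self)
  ultimately have "\<exists>W. openin (tau_ac X \<mu>) W \<and> ?e \<in> W \<and> W \<subseteq> V" by blast
  then have "V \<subseteq> ?G \<and> (\<exists>W. openin (tau_ac X \<mu>) W \<and> ?e \<in> W \<and> W \<subseteq> V)" by (simp add: V_def subset_iff)
  from tb[unfolded roelcke_totally_bounded_def, rule_format, OF this]
  obtain F where F: "finite F" "F \<subseteq> ?G"
    and cover: "range g \<subseteq> (\<Union>h\<in>F. (V #>\<^bsub>H_bac X \<mu>\<^esub> h) <#>\<^bsub>H_bac X \<mu>\<^esub> V)"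
    by (elim exE conjE)
  have "\<exists>h\<in>F. \<exists>v\<in>V. \<exists>w\<in>V. g n = compose (topspace X) (compose (topspace X) v h) w" for n
  proof -
    have "g n \<in> (\<Union>h\<in>F. (V #>\<^bsub>H_bac X \<mu>\<^esub> h) <#>\<^bsub>H_bac X \<mu>\<^esub> V)" using cover by (rule range_subsetD)
    then show ?thesis unfolding r_coset_def set_mult_def mult_H_bac by (simp; blast)
  qed
  then have "\<exists>\<^sub>F n in sequentially. \<exists>h\<in>F. r \<le> rho_ac \<mu> ?e (g n) \<and>
      (\<exists>v\<in>V. \<exists>w\<in>V. g n = compose (topspace X) (compose (topspace X) v h) w)"
    using far by (auto elim!: frequently_elim1)
  from frequently_bex_finite[OF F(1) this]
  obtain h where h: "h \<in> F" and freq: "\<exists>\<^sub>F n in sequentially. r \<le> rho_ac \<mu> ?e (g n) \<and>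
      (\<exists>v\<in>V. \<exists>w\<in>V. g n = compose (topspace X) (compose (topspace X) v h) w)"
    by (elim bexE)
  have hG: "h \<in> ?G" using h F by blast
  have homh: "homeomorphic_map X X h" using hG by (rule H_bac_homeomorphic)
  have V_le: "\<bar>measure \<mu> (v ` A) - measure \<mu> A\<bar> \<le> d / 2" if "v \<in> V" "A \<in> sets \<mu>" for v A
    using that measure_image_diff_le_rho_ac[of v A] by (auto simp: V_def)
  have V_hom: "homeomorphic_map X X v" if "v \<in> V" for v
    using that H_bac_homeomorphic by (auto simp: V_def)
  have sub: "A \<subseteq> topspace X" if "A \<in> sets \<mu>" for A
    using that sets.sets_into_space space_eq by metis
  have h_le: "\<bar>measure \<mu> (h ` A) - measure \<mu> A\<bar> \<le> d"
    if A: "A \<in> sets \<mu>" and fin: "finite (X frontier_of A)" for A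
  proof (rule field_le_epsilon)
    fix e :: real assume "0 < e"
    have "\<forall>\<^sub>F n in sequentially. \<forall>B\<in>sets \<mu>. finite (X frontier_of B) \<longrightarrow>
        card (X frontier_of B) \<le> card (X frontier_of A) \<longrightarrow>
        \<bar>measure \<mu> (g n ` B) - measure \<mu> B\<bar> \<le> e"
      by (rule tau_co_limit_measure_image_finite_frontier[OF co g \<open>0 < e\<close>])
    from frequently_ex[OF frequently_eventually_frequently[OF freq this]]
    obtain n v w where n: "\<And>B. B \<in> sets \<mu> \<Longrightarrow> finite (X frontier_of B) \<Longrightarrow>
        card (X frontier_of B) \<le> card (X frontier_of A) \<Longrightarrow>
        \<bar>measure \<mu> (g n ` B) - measure \<mu> B\<bar> \<le> e"
      and v: "v \<in> V" and w: "w \<in> V"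
      and gn: "g n = compose (topspace X) (compose (topspace X) v h) w"
      by blast
    obtain u where u: "homeomorphic_maps X X w u"
      using V_hom[OF w] homeomorphic_map_maps by blast
    then have homu: "homeomorphic_map X X u" and wu: "\<And>x. x \<in> topspace X \<Longrightarrow> w (u x) = x"
      by (auto simp: homeomorphic_maps_map)
    \<comment> \<open>\<open>B = w\<^sup>-\<^sup>1(A)\<close> changes with \<open>n\<close>, but it has as many frontier points as \<open>A\<close>.\<close>
    define B where "B = u ` A"
    have B: "B \<in> sets \<mu>" unfolding B_def by (rule homeomorphic_image_sets[OF homu A])
    have wB: "w ` B = A" using wu sub[OF A] unfolding B_def by (force simp: image_image)
    have fr: "X frontier_of B = u ` (X frontier_of A)"
      unfolding B_def by (rule homeomorphic_map_frontier_of[OF homu sub[OF A]])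
    have "\<bar>measure \<mu> (g n ` B) - measure \<mu> B\<bar> \<le> e"
      by (rule n[OF B]) (use fin in \<open>auto simp: fr card_image_le\<close>)
    moreover have "g n ` B = v ` h ` A"
    proof -
      have "w x \<in> topspace X" if "x \<in> B" for x using wB sub[OF A] that by blast
      then have "g n ` B = v ` h ` w ` B"
        using sub[OF B] unfolding gn image_image by (intro image_cong) (auto simp: compose_def)
      then show ?thesis by (simp add: wB)
    qed
    ultimately have "\<bar>measure \<mu> (v ` h ` A) - measure \<mu> B\<bar> \<le> e" by simp
    then show "\<bar>measure \<mu> (h ` A) - measure \<mu> A\<bar> \<le> d + e"
      using V_le[OF w B] V_le[OF v homeomorphic_image_sets[OF homh A]] unfolding wB by linarith
  qed
  have h_all: "\<bar>measure \<mu> (h ` A) - measure \<mu> A\<bar> \<le> d" if "A \<in> sets \<mu>" for A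
    by (rule measure_image_diff_le_if_finite_frontier[OF hG h_le that])
  obtain n v w where n: "r \<le> rho_ac \<mu> ?e (g n)" and v: "v \<in> V" and w: "w \<in> V"
    and gn: "g n = compose (topspace X) (compose (topspace X) v h) w"
    using frequently_ex[OF freq] by blast
  obtain P where P: "P \<in> sets \<mu>" "rho_ac \<mu> ?e (g n) = 2 * (measure \<mu> (g n ` P) - measure \<mu> P)"
    using rho_ac_eq_measure_image_diff[OF g] by metis
  have wP: "w ` P \<in> sets \<mu>" by (rule homeomorphic_image_sets[OF V_hom[OF w] P(1)])
  have hwP: "h ` w ` P \<in> sets \<mu>" by (rule homeomorphic_image_sets[OF homh wP])
  have "g n ` P = v ` h ` w ` P"
    using sub[OF P(1)] sub[OF wP] unfolding gn image_image by (intro image_cong) (auto simp: compose_def)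
  then have "rho_ac \<mu> ?e (g n) = 2 * (measure \<mu> (v ` h ` w ` P) - measure \<mu> P)" using P(2) by simp
  also have "measure \<mu> (v ` h ` w ` P) - measure \<mu> P \<le> d / 2 + d + d / 2"
    using abs_le_D1[OF V_le[OF v hwP]] abs_le_D1[OF h_all[OF wP]] abs_le_D1[OF V_le[OF w P(1)]] by linarith
  finally have "rho_ac \<mu> ?e (g n) \<le> 4 * d" by simp
  then show False using n r by (simp add: d_def)
qed

end

section \<open>One-dimensional manifolds\<close>

lemma homeomorphic_maps_Euclidean_half_space_1:
  "homeomorphic_maps (Euclidean_half_space 1) (top_of_set {0..}) (\<lambda>x. x 0) (\<lambda>t i. if i = 0 then t else 0)"
  unfolding homeomorphic_maps_def
proof (intro conjI ballI)
  show "continuous_map (Euclidean_half_space 1) (top_of_set {0..}) (\<lambda>x. x 0)"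
    unfolding Euclidean_half_space_def Euclidean_space_def
    by (auto simp: continuous_map_in_subtopology subtopology_subtopology
        intro!: continuous_map_from_subtopology continuous_map_product_projection)
  show "continuous_map (top_of_set {0..}) (Euclidean_half_space 1) (\<lambda>t i. if i = 0 then t else 0)"
    unfolding Euclidean_half_space_def Euclidean_space_def
    by (auto simp: continuous_map_in_subtopology continuous_map_componentwise_UNIV
        intro!: continuous_map_from_subtopology)
next
  fix x assume "x \<in> topspace (Euclidean_half_space 1)"
  then show "(\<lambda>i. if i = 0 then x 0 else 0) = x"
    by (auto simp: Euclidean_half_space_def topspace_Euclidean_space)
qed auto

lemma topological_manifold_1_chart:
  assumes X: "topological_manifold 1 X" and x: "x \<in> topspace X"
  obtains U T \<psi> \<gamma> where "openin X U" "x \<in> U" "openin (top_of_set {0..}) (T :: real set)"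
    "homeomorphic_maps (subtopology X U) (top_of_set T) \<psi> \<gamma>"
proof -
  obtain U V where U: "openin X U" "x \<in> U" and V: "openin (Euclidean_half_space 1) V"
    and hs: "subtopology X U homeomorphic_space subtopology (Euclidean_half_space 1) V"
    using X x unfolding topological_manifold_def by blast
  obtain f g where fg: "homeomorphic_maps (subtopology X U) (subtopology (Euclidean_half_space 1) V) f g"
    using hs unfolding homeomorphic_space_def by blast
  let ?p = "\<lambda>x::nat \<Rightarrow> real. x 0" and ?i = "\<lambda>t i::nat. if i = 0 then t else (0::real)"
  have VX: "V \<subseteq> topspace (Euclidean_half_space 1)" using V by (rule openin_subset)
  have "homeomorphic_map (Euclidean_half_space 1) (top_of_set {0..}) ?p"
    using homeomorphic_maps_Euclidean_half_space_1 homeomorphic_maps_map by blast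
  then have T: "openin (top_of_set {0..}) (?p ` V)"
    using V homeomorphic_map_openness_eq by blast
  have "homeomorphic_maps (subtopology (Euclidean_half_space 1) V) (subtopology (top_of_set {0..}) (?p ` V)) ?p ?i"
    by (rule homeomorphic_maps_subtopologies[OF homeomorphic_maps_Euclidean_half_space_1])
      (use VX openin_subset[OF T] in \<open>auto simp: Int_absorb1\<close>)
  then have "homeomorphic_maps (subtopology (Euclidean_half_space 1) V) (top_of_set (?p ` V)) ?p ?i"
    using openin_subset[OF T] by (simp add: subtopology_subtopology Int_absorb1)
  then show ?thesis
    using that[OF U T] homeomorphic_maps_compose[OF conjI[OF fg]] by blast
qed

lemma half_line_small_ball:
  fixes T :: "real set"
  assumes T: "openin (top_of_set {0..}) T" and t: "t \<in> T"
  obtains r where "0 < r" "{0..} \<inter> cball t r \<subseteq> T"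
  using assms by (metis openin_contains_cball inf_commute that)

text \<open>
In a chart onto a relatively open subset of the half-line, small intervals around a point are
connected, and their closure adds at most the two endpoints. The closure in \<open>X\<close> adds nothing else,
since the image of the compact interval is closed in the Hausdorff space \<open>X\<close>.
\<close>
lemma topological_manifold_1_base:
  assumes X: "topological_manifold 1 X" and Q: "openin X Q'" "x \<in> Q'"
  shows "\<exists>W. openin X W \<and> x \<in> W \<and> W \<subseteq> Q' \<and> connectedin X W \<and> finite (X frontier_of W)"
proof -
  have Haus: "Hausdorff_space X" using X by (simp add: topological_manifold_def)
  have xX: "x \<in> topspace X" using Q openin_subset by blast
  obtain U T \<psi> \<gamma> where U: "openin X U" "x \<in> U" and T: "openin (top_of_set {0..}) (T :: real set)"
    and hm: "homeomorphic_maps (subtopology X U) (top_of_set T) \<psi> \<gamma>"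
    using topological_manifold_1_chart[OF X xX] by metis
  have UX: "U \<subseteq> topspace X" using U openin_subset by blast
  have h\<psi>: "homeomorphic_map (subtopology X U) (top_of_set T) \<psi>"
    and h\<gamma>: "homeomorphic_map (top_of_set T) (subtopology X U) \<gamma>"
    and \<gamma>\<psi>: "\<And>y. y \<in> U \<Longrightarrow> \<gamma> (\<psi> y) = y" and \<psi>\<gamma>: "\<And>t. t \<in> T \<Longrightarrow> \<psi> (\<gamma> t) = t"
    using hm UX by (auto simp: homeomorphic_maps_map)
  have \<psi>U: "\<psi> ` U = T" using homeomorphic_imp_surjective_map[OF h\<psi>] UX by (simp add: Int_absorb1)
  define S where "S = \<psi> ` (U \<inter> Q')"
  have "openin (subtopology X U) (U \<inter> Q')" using U Q by (simp add: openin_open_subtopology openin_Int)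
  then have "openin (top_of_set T) S"
    unfolding S_def using h\<psi> homeomorphic_map_openness_eq by blast
  then have S: "openin (top_of_set {0..}) S" using T by (rule openin_trans)
  have "\<psi> x \<in> S" unfolding S_def using U Q by blast
  then obtain r where r: "0 < r" "{0..} \<inter> cball (\<psi> x) r \<subseteq> S"
    using half_line_small_ball[OF S] by metis
  have ST: "S \<subseteq> T" unfolding S_def using \<psi>U by blast
  have x0: "0 \<le> \<psi> x" using \<open>\<psi> x \<in> S\<close> openin_subset[OF S] by auto
  define I where "I = {0..} \<inter> ball (\<psi> x) r"
  define J where "J = {0..} \<inter> cball (\<psi> x) r"
  have IJ: "I \<subseteq> J" "J \<subseteq> T" unfolding I_def J_def using r(2) ST by auto
  have cont: "continuous_map (top_of_set T) X \<gamma>"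
    using homeomorphic_imp_continuous_map[OF h\<gamma>] continuous_map_in_subtopology by blast
  have "openin (top_of_set {0..}) I" unfolding I_def by (simp add: openin_open_Int)
  then have "openin (top_of_set T) I"
    using IJ openin_subset[OF T] by (metis openin_subset_trans subset_trans topspace_euclidean_subtopology)
  then have "openin (subtopology X U) (\<gamma> ` I)"
    using h\<gamma> homeomorphic_map_openness_eq by blast
  then have W: "openin X (\<gamma> ` I)" using U by (simp add: openin_open_subtopology)
  have "connected I" unfolding I_def by (intro convex_connected convex_Int) auto
  then have "connectedin (top_of_set T) I" using IJ by (simp add: connectedin_subtopology)
  then have con: "connectedin X (\<gamma> ` I)" using cont connectedin_continuous_map_image by blast
  have "compact J" unfolding J_def by (simp add: closed_Int_compact)
  then have "compactin (top_of_set T) J" using IJ by (simp add: compactin_subtopology)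
  then have "closedin X (\<gamma> ` J)"
    using cont image_compactin compactin_imp_closedin[OF Haus] by blast
  then have "X closure_of (\<gamma> ` I) \<subseteq> \<gamma> ` J" using IJ by (intro closure_of_minimal) auto
  then have "X frontier_of (\<gamma> ` I) \<subseteq> \<gamma> ` J - \<gamma> ` I"
    using W by (auto simp: frontier_of_def interior_of_openin)
  also have "\<dots> \<subseteq> \<gamma> ` {\<psi> x - r, \<psi> x + r}"
  proof
    fix y assume "y \<in> \<gamma> ` J - \<gamma> ` I"
    then obtain t where t: "y = \<gamma> t" "t \<in> J" "t \<notin> I" by blast
    then have "\<bar>\<psi> x - t\<bar> = r" unfolding I_def J_def by (auto simp: dist_real_def)
    then have "t = \<psi> x - r \<or> t = \<psi> x + r" by linarith
    then show "y \<in> \<gamma> ` {\<psi> x - r, \<psi> x + r}" using t by blast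
  qed
  finally have fin: "finite (X frontier_of (\<gamma> ` I))" by (rule finite_subset) simp
  have "\<psi> x \<in> I" using r(1) x0 unfolding I_def by simp
  then have "x \<in> \<gamma> ` I" using \<gamma>\<psi>[OF U(2)] by force
  moreover have "\<gamma> ` I \<subseteq> Q'"
  proof -
    have "I \<subseteq> \<psi> ` (U \<inter> Q')" using r(2) unfolding I_def S_def by auto
    then show ?thesis using \<gamma>\<psi> by fastforce
  qed
  ultimately show ?thesis using W con fin by blast
qed

lemma OU_pair_1_finite_frontier_base_measure:
  assumes "OU_pair 1 X \<mu>"
  shows "finite_frontier_base_measure X \<mu>"
proof -
  have OU: "topological_manifold 1 X" "compact_space X" "space \<mu> = topspace X"
    "sets \<mu> = sigma_sets (topspace X) {U. openin X U}" "finite_measure \<mu>"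
    "\<And>x. x \<in> topspace X \<Longrightarrow> {x} \<in> null_sets \<mu>"
    using assms unfolding OU_pair_def by (elim conjE, assumption | blast)+
  have mf: "Hausdorff_space X" "second_countable X"
    using OU(1) unfolding topological_manifold_def by blast+
  show ?thesis
  proof (intro finite_frontier_base_measure.intro finite_frontier_base_measure_axioms.intro
      finite_borel_measure_on.intro finite_borel_measure_on_axioms.intro)
    show "\<exists>W. openin X W \<and> x \<in> W \<and> W \<subseteq> U \<and> connectedin X W \<and> finite (X frontier_of W)"
      if "openin X U" "x \<in> U" for U x
      by (rule topological_manifold_1_base[OF OU(1) that])
  qed (fact OU mf)+
qed

section \<open>An arc parametrized by its measure\<close>

text \<open>
Let \<open>\<gamma>\<close> parametrize an arc in the interior of a chart by \<open>[a, b]\<close>. The function \<open>t \<mapsto> \<mu>(\<gamma>([a, t]))\<close> is continuous because \<open>\<mu>\<close> has no atoms, and strictly increasing because open sets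
have positive measure. Composing \<open>\<gamma>\<close> with its inverse gives the required parameter. Continuity is read
off from the distribution function of the image of \<open>\<mu>\<close> under the chart.
\<close>
lemma (in finite_frontier_base_measure) measure_parametrized_arc_exists:
  assumes X: "topological_manifold 1 X" and ne: "topspace X \<noteq> {}"
    and pos: "\<And>U. openin X U \<Longrightarrow> U \<noteq> {} \<Longrightarrow> 0 < emeasure \<mu> U"
  obtains L \<gamma> where "0 < L" "continuous_map (top_of_set {0..L}) X \<gamma>" "inj_on \<gamma> {0..L}"
    "openin X (\<gamma> ` {0<..<L})" "\<And>s. s \<in> {0..L} \<Longrightarrow> measure \<mu> (\<gamma> ` {0..s}) = (s::real)"
proof -
  obtain x where xX: "x \<in> topspace X" using ne by blast
  obtain U T \<psi> \<gamma> where U: "openin X U" "x \<in> U" and T: "openin (top_of_set {0..}) (T :: real set)"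
    and hm: "homeomorphic_maps (subtopology X U) (top_of_set T) \<psi> \<gamma>"
    using topological_manifold_1_chart[OF X xX] by metis
  have UX: "U \<subseteq> topspace X" using U openin_subset by blast
  have h\<psi>: "homeomorphic_map (subtopology X U) (top_of_set T) \<psi>"
    and h\<gamma>: "homeomorphic_map (top_of_set T) (subtopology X U) \<gamma>"
    and \<psi>\<gamma>: "\<And>t. t \<in> T \<Longrightarrow> \<psi> (\<gamma> t) = t"
    using hm UX by (auto simp: homeomorphic_maps_map)
  have cont: "continuous_map (top_of_set T) X \<gamma>"
    using homeomorphic_imp_continuous_map[OF h\<gamma>] continuous_map_in_subtopology by blast
  have \<gamma>X: "\<gamma> t \<in> topspace X" if "t \<in> T" for t
    using continuous_map_image_subset_topspace[OF cont] that by auto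
  have "\<psi> x \<in> T" using homeomorphic_imp_surjective_map[OF h\<psi>] U UX by auto
  then obtain r where r: "0 < r" "{0..} \<inter> cball (\<psi> x) r \<subseteq> T"
    using half_line_small_ball[OF T] by metis
  have x0: "0 \<le> \<psi> x" using \<open>\<psi> x \<in> T\<close> openin_subset[OF T] by auto
  \<comment> \<open>To the right of the coordinate of \<open>x\<close> there is room for an interval even if \<open>x\<close> is a boundary point.\<close>
  define a where "a = \<psi> x + r / 3"
  define b where "b = \<psi> x + r / 2"
  have ab: "a < b" unfolding a_def b_def using r by auto
  have abT: "{a..b} \<subseteq> T"
    using r x0 unfolding a_def b_def by (intro subset_trans[OF _ r(2)]) (auto simp: dist_real_def)
  have op: "openin X (\<gamma> ` I)" if "open I" "I \<subseteq> {a..b}" for I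
  proof -
    have "openin (top_of_set T) I"
      using that abT by (simp add: open_subset)
    then have "openin (subtopology X U) (\<gamma> ` I)" using h\<gamma> homeomorphic_map_openness_eq by blast
    then show ?thesis using U by (simp add: openin_open_subtopology)
  qed
  have cl: "\<gamma> ` {c..d} \<in> sets \<mu>" if "a \<le> c" "d \<le> b" for c d
  proof -
    have "compactin (top_of_set T) {c..d}" using abT that by (auto simp: compactin_subtopology)
    then show ?thesis
      using cont image_compactin compactin_imp_closedin[OF Hausdorff] closedin_sets by blast
  qed
  have inj: "inj_on \<gamma> {a..b}" using \<psi>\<gamma> abT by (metis inj_on_inverseI subsetD)
  let ?K = "\<gamma> ` {a..b}"
  \<comment> \<open>The chart coordinate; the value off the arc avoids \<open>[a, b]\<close>, so no mass is added there.\<close>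
  define \<theta> where "\<theta> y = (if y \<in> ?K then \<psi> y else b + 1)" for y
  have \<theta>\<gamma>: "\<theta> (\<gamma> t) = t" if "t \<in> {a..b}" for t using that abT \<psi>\<gamma> by (auto simp: \<theta>_def)
  have KX: "?K \<subseteq> topspace X" using \<gamma>X abT by auto
  have le: "{w \<in> space \<mu>. \<theta> w \<le> c} = \<gamma> ` {a..min b c}" if "c < b + 1" for c
  proof (intro equalityI subsetI)
    fix w assume w: "w \<in> {w \<in> space \<mu>. \<theta> w \<le> c}"
    then have "w \<in> ?K" using that by (auto simp: \<theta>_def split: if_splits)
    then obtain t where "t \<in> {a..b}" "w = \<gamma> t" by blast
    then show "w \<in> \<gamma> ` {a..min b c}" using w \<theta>\<gamma> by auto
  next
    fix w assume "w \<in> \<gamma> ` {a..min b c}"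
    then obtain t where "t \<in> {a..min b c}" "w = \<gamma> t" by blast
    then show "w \<in> {w \<in> space \<mu>. \<theta> w \<le> c}" using \<theta>\<gamma>[of t] KX by (auto simp: space_eq)
  qed
  have meas [measurable]: "\<theta> \<in> borel_measurable \<mu>"
    unfolding borel_measurable_iff_le
  proof
    fix c
    show "{w \<in> space \<mu>. \<theta> w \<le> c} \<in> sets \<mu>"
    proof (cases "c < b + 1")
      case True
      then show ?thesis by (simp add: le cl)
    next
      case False
      have "\<theta> w \<le> c" for w
        using False ab \<psi>\<gamma> abT by (auto simp: \<theta>_def)
      then show ?thesis by simp
    qed
  qed
  define N where "N = distr \<mu> borel \<theta>"
  interpret N: finite_borel_measure N
    unfolding N_def by (intro finite_borel_measure.intro finite_measure_distr)
      (auto intro!: finite_borel_measure_axioms.intro)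
  define F where "F = cdf N"
  have F_eq: "F t = measure \<mu> (\<gamma> ` {a..t})" if "t \<in> {a..b}" for t
  proof -
    have "F t = measure \<mu> (\<theta> -` {..t} \<inter> space \<mu>)"
      unfolding F_def cdf_def N_def by (subst measure_distr) auto
    also have "\<theta> -` {..t} \<inter> space \<mu> = {w \<in> space \<mu>. \<theta> w \<le> t}" by auto
    also have "\<dots> = \<gamma> ` {a..t}" using le[of t] that by (simp add: min_absorb2)
    finally show ?thesis .
  qed
  have F_cont: "continuous_on {a..b} F"
  proof (intro continuous_at_imp_continuous_on ballI)
    fix t assume t: "t \<in> {a..b}"
    have "measure N {t} = measure \<mu> (\<theta> -` {t} \<inter> space \<mu>)"
      unfolding N_def by (subst measure_distr) auto
    also have "\<theta> -` {t} \<inter> space \<mu> = {\<gamma> t}"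
      using t \<theta>\<gamma> KX by (auto simp: space_eq \<theta>_def split: if_splits)
    also have "measure \<mu> {\<gamma> t} = 0"
      using null_singleton[of "\<gamma> t"] \<gamma>X t abT by (simp add: measure_def null_setsD1 subsetD)
    finally show "isCont F t" unfolding F_def N.isCont_cdf .
  qed
  have F_less: "F s < F t" if st: "s \<in> {a..b}" "t \<in> {a..b}" "s < t" for s t
  proof -
    have "\<gamma> ` {s<..<t} \<noteq> {}" using st by simp
    then have "0 < emeasure \<mu> (\<gamma> ` {s<..<t})" using st by (intro pos op) auto
    then have "0 < measure \<mu> (\<gamma> ` {s<..<t})" by (simp add: emeasure_eq_measure)
    moreover have "measure \<mu> (\<gamma> ` {a..s} \<union> \<gamma> ` {s<..<t}) = measure \<mu> (\<gamma> ` {a..s}) + measure \<mu> (\<gamma> ` {s<..<t})"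
    proof (rule finite_measure_Union)
      show "\<gamma> ` {s<..<t} \<in> sets \<mu>" using st by (intro openin_sets op) auto
      have "\<gamma> ` {a..s} \<inter> \<gamma> ` {s<..<t} = \<gamma> ` ({a..s} \<inter> {s<..<t})"
        using st by (intro inj_on_image_Int[OF inj, symmetric]) auto
      also have "{a..s} \<inter> {s<..<t} = {}" by auto
      finally show "\<gamma> ` {a..s} \<inter> \<gamma> ` {s<..<t} = {}" by simp
    qed (use st in \<open>simp add: cl\<close>)
    moreover have "measure \<mu> (\<gamma> ` {a..s} \<union> \<gamma> ` {s<..<t}) \<le> measure \<mu> (\<gamma> ` {a..t})"
      using st by (intro finite_measure_mono cl) auto
    ultimately show ?thesis using st F_eq by simp
  qed
  have F_a: "F a = 0"
    using F_eq[of a] ab null_singleton[of "\<gamma> a"] \<gamma>X[of a] abT by (simp add: measure_def null_setsD1 subsetD)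
  define L where "L = F b"
  have L: "0 < L" unfolding L_def using F_less[of a b] ab F_a by simp
  have F_le: "F s \<le> F t \<longleftrightarrow> s \<le> t" if "s \<in> {a..b}" "t \<in> {a..b}" for s t
    using F_less that by (metis linorder_not_le order_le_less)
  have F_inj: "inj_on F {a..b}" using F_le by (metis inj_onI order_antisym order_refl)
  have F_img: "F ` {a..b} = {0..L}"
  proof
    show "F ` {a..b} \<subseteq> {0..L}" using F_le F_a ab unfolding L_def by (metis atLeastAtMost_iff image_subsetI less_imp_le order_refl)
    show "{0..L} \<subseteq> F ` {a..b}"
    proof
      fix y assume "y \<in> {0..L}"
      then show "y \<in> F ` {a..b}" using IVT'[of F a y b] F_cont F_a ab unfolding L_def by force
    qed
  qed
  define G where "G = inv_into {a..b} F"
  have GF: "G (F t) = t" if "t \<in> {a..b}" for t unfolding G_def using F_inj that by simp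
  have FG: "F (G s) = s" and G_mem: "G s \<in> {a..b}" if "s \<in> {0..L}" for s
    unfolding G_def using that by (intro f_inv_into_f inv_into_into; simp add: F_img)+
  have G_cont: "continuous_on {0..L} G"
    using continuous_on_inv[OF F_cont, of G] GF by (simp add: F_img)
  have G_img: "G ` {0..s} = {a..G s}" if s: "s \<in> {0..L}" for s
  proof (intro equalityI subsetI)
    fix t assume "t \<in> G ` {0..s}"
    then obtain u where "u \<in> {0..s}" "t = G u" by blast
    moreover from this have "G u \<le> G s" using F_le[OF G_mem G_mem, of u s] FG[of u] FG[of s] s by simp
    ultimately show "t \<in> {a..G s}" using G_mem[of u] s by auto
  next
    fix t assume t: "t \<in> {a..G s}"
    then have tab: "t \<in> {a..b}" using G_mem[OF s] by auto
    have "F t \<le> s" using F_le[OF tab G_mem[OF s]] FG[OF s] t by simp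
    moreover have "0 \<le> F t" using F_img tab by auto
    ultimately show "t \<in> G ` {0..s}" using GF[OF tab] by force
  qed
  have G_open: "G ` {0<..<L} = {a<..<b}"
  proof (intro equalityI subsetI)
    fix t assume "t \<in> G ` {0<..<L}"
    then obtain u where u: "u \<in> {0<..<L}" "t = G u" by blast
    then have "t \<in> {a..b}" "F t = u" using G_mem FG by auto
    then show "t \<in> {a<..<b}" using F_a u unfolding L_def by (auto simp: order.order_iff_strict)
  next
    fix t assume t: "t \<in> {a<..<b}"
    then have "F a < F t" "F t < F b" by (auto intro!: F_less)
    then show "t \<in> G ` {0<..<L}" using GF[of t] t F_a unfolding L_def by force
  qed
  have G_inj: "inj_on G {0..L}" by (rule inj_on_inverseI[of _ F]) (rule FG)
  show ?thesis
  proof (rule that[of L "\<gamma> \<circ> G"])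
    have "continuous_map (top_of_set {0..L}) (top_of_set T) G"
      using G_cont G_mem abT by (auto simp: continuous_map_in_subtopology)
    then show "continuous_map (top_of_set {0..L}) X (\<gamma> \<circ> G)" using cont by (rule continuous_map_compose)
    show "inj_on (\<gamma> \<circ> G) {0..L}"
      by (rule comp_inj_on[OF G_inj inj_on_subset[OF inj]]) (use G_mem in auto)
    show "openin X ((\<gamma> \<circ> G) ` {0<..<L})"
      unfolding image_comp[symmetric] G_open by (intro op) auto
    show "measure \<mu> ((\<gamma> \<circ> G) ` {0..s}) = s" if "s \<in> {0..L}" for s
      unfolding image_comp[symmetric] G_img[OF that] using F_eq[OF G_mem[OF that]] FG[OF that] by simp
  qed (rule L)
qed

locale measure_parametrized_arc = finite_frontier_base_measure X \<mu>
  for X :: "'a topology" and \<mu> +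
  fixes L :: real and \<gamma> :: "real \<Rightarrow> 'a"
  assumes L_pos: "0 < L"
    and \<gamma>_cont: "continuous_map (top_of_set {0..L}) X \<gamma>"
    and \<gamma>_inj: "inj_on \<gamma> {0..L}"
    and \<gamma>_open: "openin X (\<gamma> ` {0<..<L})"
    and \<gamma>_measure: "s \<in> {0..L} \<Longrightarrow> measure \<mu> (\<gamma> ` {0..s}) = s"
begin

definition arc :: "'a set" where "arc = \<gamma> ` {0..L}"

text \<open>
The inverse of \<open>\<gamma>\<close> on the arc. Points off the arc get the value \<open>L + 1\<close> outside the range of
parameters, so that images of sets of parameters are exactly their preimages under the coordinate.
\<close>
definition arc_coord :: "'a \<Rightarrow> real" where
  "arc_coord x = (if x \<in> arc then inv_into {0..L} \<gamma> x else L + 1)"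

lemma \<gamma>_in_topspace: "t \<in> {0..L} \<Longrightarrow> \<gamma> t \<in> topspace X"
  using continuous_map_image_subset_topspace[OF \<gamma>_cont] by auto

lemma arc_subset: "arc \<subseteq> topspace X"
  using \<gamma>_in_topspace by (auto simp: arc_def)

lemma arc_coord_\<gamma>: "t \<in> {0..L} \<Longrightarrow> arc_coord (\<gamma> t) = t"
  using \<gamma>_inj by (simp add: arc_coord_def arc_def)

lemma \<gamma>_arc_coord: "x \<in> arc \<Longrightarrow> \<gamma> (arc_coord x) = x"
  by (auto simp: arc_def arc_coord_\<gamma>)

lemma arc_coord_in: "x \<in> arc \<Longrightarrow> arc_coord x \<in> {0..L}"
  using arc_coord_\<gamma> unfolding arc_def by force

lemma closedin_\<gamma>_image: "compact S \<Longrightarrow> S \<subseteq> {0..L} \<Longrightarrow> closedin X (\<gamma> ` S)"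
  using image_compactin[OF _ \<gamma>_cont, of S] compactin_imp_closedin[OF Hausdorff]
  by (simp add: compactin_subtopology)

lemma closedin_arc: "closedin X arc"
  unfolding arc_def by (rule closedin_\<gamma>_image) auto

lemma \<gamma>_image_eq_vimage: "B \<subseteq> {0..L} \<Longrightarrow> \<gamma> ` B = arc_coord -` B \<inter> space \<mu>"
proof (intro equalityI subsetI)
  fix x assume B: "B \<subseteq> {0..L}" and "x \<in> arc_coord -` B \<inter> space \<mu>"
  then have x: "arc_coord x \<in> B" by simp
  then have "x \<in> arc" using B by (auto simp: arc_coord_def split: if_splits)
  then show "x \<in> \<gamma> ` B" using x \<gamma>_arc_coord by force
qed (use arc_coord_\<gamma> \<gamma>_in_topspace in \<open>auto simp: space_eq subset_iff\<close>)

lemma borel_measurable_arc_coord [measurable]: "arc_coord \<in> borel_measurable \<mu>"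
  unfolding borel_measurable_iff_le
proof
  fix c
  show "{x \<in> space \<mu>. arc_coord x \<le> c} \<in> sets \<mu>"
  proof (cases "c < L + 1")
    case True
    then have "{x \<in> space \<mu>. arc_coord x \<le> c} = arc_coord -` ({0..L} \<inter> {..c}) \<inter> space \<mu>"
      using arc_coord_in by (auto simp: arc_coord_def split: if_splits)
    also have "\<dots> = \<gamma> ` ({0..L} \<inter> {..c})" by (rule \<gamma>_image_eq_vimage[symmetric]) auto
    finally show ?thesis
      using closedin_sets[OF closedin_\<gamma>_image, of "{0..L} \<inter> {..c}"]
      by (simp add: compact_Int_closed)
  next
    case False
    have "arc_coord x \<le> c" for x
      using False arc_coord_in[of x] by (cases "x \<in> arc") (auto simp: arc_coord_def)
    then show ?thesis by simp
  qed
qed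

lemma \<gamma>_image_sets: "B \<in> sets borel \<Longrightarrow> B \<subseteq> {0..L} \<Longrightarrow> \<gamma> ` B \<in> sets \<mu>"
  using measurable_sets[OF borel_measurable_arc_coord, of B] by (simp add: \<gamma>_image_eq_vimage)

text \<open>
Restricted to \<open>[0, L]\<close>, both sides are finite measures on the line that agree on all half-lines.
\<close>
lemma emeasure_\<gamma>_image:
  assumes B: "B \<in> sets borel" "B \<subseteq> {0..L}"
  shows "emeasure \<mu> (\<gamma> ` B) = emeasure lborel B"
proof -
  have arc_sets: "arc \<in> sets \<mu>" by (rule closedin_sets[OF closedin_arc])
  \<comment> \<open>The part of \<open>\<mu>\<close> on the arc, transported to the line, is compared with Lebesgue measure on \<open>[0, L]\<close>.\<close>
  let ?M = "distr (density \<mu> (indicator arc)) borel arc_coord"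
  let ?N = "density lborel (indicator {0..L}) :: real measure"
  have M: "emeasure ?M S = emeasure \<mu> (\<gamma> ` ({0..L} \<inter> S))" if S: "S \<in> sets borel" for S
  proof -
    have "emeasure ?M S = emeasure (density \<mu> (indicator arc)) (arc_coord -` S \<inter> space \<mu>)"
      using S by (subst emeasure_distr) auto
    also have "\<dots> = emeasure \<mu> (arc \<inter> (arc_coord -` S \<inter> space \<mu>))"
      using S arc_sets by (intro emeasure_restricted) auto
    also have "arc \<inter> (arc_coord -` S \<inter> space \<mu>) = arc_coord -` ({0..L} \<inter> S) \<inter> space \<mu>"
      using arc_coord_in by (auto simp: arc_coord_def split: if_splits)
    also have "\<dots> = \<gamma> ` ({0..L} \<inter> S)" by (rule \<gamma>_image_eq_vimage[symmetric]) auto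
    finally show ?thesis .
  qed
  have N: "emeasure ?N S = emeasure lborel ({0..L} \<inter> S)" if S: "S \<in> sets borel" for S
    using S by (intro emeasure_restricted) auto
  have "?M = ?N"
  proof (rule measure_eqI_lessThan)
    show "emeasure ?M {x<..} < \<infinity>" for x
      by (simp add: M less_top[symmetric])
    show "emeasure ?M {x<..} = emeasure ?N {x<..}" for x
    proof -
      consider "x < 0" | "x \<in> {0..L}" | "L < x" by fastforce
      then show ?thesis
      proof cases
        case 1
        then have "{0..L} \<inter> {x<..} = {0..L}" by auto
        then show ?thesis using L_pos \<gamma>_measure[of L] by (simp add: M N emeasure_eq_measure)
      next
        case 2
        then have I: "{0..L} \<inter> {x<..} = {0..L} - {0..x}" "{0..L} \<inter> {x<..} = {x<..L}" by auto
        have "\<gamma> ` ({0..L} \<inter> {x<..}) = \<gamma> ` {0..L} - \<gamma> ` {0..x}"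
          unfolding I(1) using 2 by (intro inj_on_image_set_diff[OF \<gamma>_inj]) auto
        moreover have "measure \<mu> (\<gamma> ` {0..L} - \<gamma> ` {0..x}) = measure \<mu> (\<gamma> ` {0..L}) - measure \<mu> (\<gamma> ` {0..x})"
          using 2 by (intro finite_measure_Diff \<gamma>_image_sets) auto
        ultimately have "emeasure \<mu> (\<gamma> ` ({0..L} \<inter> {x<..})) = ennreal (L - x)"
          using L_pos \<gamma>_measure[of L] \<gamma>_measure[OF 2] by (simp add: emeasure_eq_measure)
        moreover have "emeasure lborel ({0..L} \<inter> {x<..}) = ennreal (L - x)"
          unfolding I(2) using 2 by simp
        ultimately show ?thesis by (simp add: M N)
      next
        case 3
        then have "{0..L} \<inter> {x<..} = {}" by auto
        then show ?thesis by (simp add: M N)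
      qed
    qed
  qed simp_all
  then have "emeasure \<mu> (\<gamma> ` ({0..L} \<inter> B)) = emeasure lborel ({0..L} \<inter> B)"
    using M[OF B(1)] N[OF B(1)] by simp
  then show ?thesis using B(2) by (simp add: Int_absorb1)
qed

lemma arc_Int_sets_eq_\<gamma>_image:
  assumes A: "A \<in> sets \<mu>"
  obtains B where "B \<in> sets borel" "B \<subseteq> {0..L}" "A \<inter> arc = \<gamma> ` B"
proof
  have "\<gamma> \<in> measurable (restrict_space borel {0..L}) \<mu>"
  proof (rule measurable_sigma_sets[OF sets_eq])
    show "{U. openin X U} \<subseteq> Pow (topspace X)" using openin_subset by auto
    show "\<gamma> \<in> space (restrict_space borel {0..L}) \<rightarrow> topspace X"
      using \<gamma>_in_topspace by (auto simp: space_restrict_space)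
    fix U assume "U \<in> {U. openin X U}"
    then have "openin (top_of_set {0..L}) {t \<in> topspace (top_of_set {0..L}). \<gamma> t \<in> U}"
      using openin_continuous_map_preimage[OF \<gamma>_cont, of U] by simp
    then obtain S where "open S" "{t \<in> {0..L}. \<gamma> t \<in> U} = {0..L} \<inter> S"
      by (auto simp: openin_open)
    then show "\<gamma> -` U \<inter> space (restrict_space borel {0..L}) \<in> sets (restrict_space borel {0..L})"
      by (auto simp: space_restrict_space sets_restrict_space vimage_def Int_def conj_commute intro!: image_eqI[of _ _ S])
  qed
  from measurable_sets[OF this A]
  have "\<gamma> -` A \<inter> {0..L} \<in> sets (restrict_space borel {0..L})"
    by (simp add: space_restrict_space)
  then show "\<gamma> -` A \<inter> {0..L} \<in> sets borel" by (simp add: sets_restrict_space_iff)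
  show "A \<inter> arc = \<gamma> ` (\<gamma> -` A \<inter> {0..L})" by (auto simp: arc_def)
qed auto

section \<open>Homeomorphisms supported on an arc\<close>

lemma negligible_Lipschitz_image_real:
  fixes f :: "real \<Rightarrow> real"
  assumes "negligible S" "\<And>s t. s \<in> S \<Longrightarrow> t \<in> S \<Longrightarrow> \<bar>f s - f t\<bar> \<le> C * \<bar>s - t\<bar>"
  shows "negligible (f ` S)"
proof (rule negligible_locally_Lipschitz_image[OF _ assms(1)])
  fix x assume "x \<in> S"
  then show "\<exists>T B. open T \<and> x \<in> T \<and> (\<forall>y\<in>S \<inter> T. norm (f y - f x) \<le> B * norm (y - x))"
    using assms(2) by (intro exI[of _ UNIV] exI[of _ C]) auto
qed simp

lemma emeasure_lborel_eq_0_iff_negligible: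
  fixes B :: "real set"
  assumes "B \<in> sets borel"
  shows "emeasure lborel B = 0 \<longleftrightarrow> negligible B"
  using assms by (simp add: negligible_iff_null_sets null_sets_def emeasure_completion)

definition arc_map :: "(real \<Rightarrow> real) \<Rightarrow> 'a \<Rightarrow> 'a" where
  "arc_map \<phi> = (\<lambda>x\<in>topspace X. if x \<in> arc then \<gamma> (\<phi> (arc_coord x)) else x)"

lemma arc_map_\<gamma>: "t \<in> {0..L} \<Longrightarrow> arc_map \<phi> (\<gamma> t) = \<gamma> (\<phi> t)"
  using \<gamma>_in_topspace by (simp add: arc_map_def arc_coord_\<gamma>) (simp add: arc_def)

lemma arc_map_outside: "x \<in> topspace X \<Longrightarrow> x \<notin> arc \<Longrightarrow> arc_map \<phi> x = x"
  by (simp add: arc_map_def)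

lemma arc_map_\<gamma>_image: "B \<subseteq> {0..L} \<Longrightarrow> arc_map \<phi> ` \<gamma> ` B = \<gamma> ` \<phi> ` B"
  unfolding image_image by (rule image_cong) (auto simp: arc_map_\<gamma> subset_iff)

context
  fixes \<phi> :: "real \<Rightarrow> real" and C D :: real
  assumes \<phi>0: "\<phi> 0 = 0" and \<phi>L: "\<phi> L = L"
    and C: "0 < C"
    and lower: "\<And>s t. s \<in> {0..L} \<Longrightarrow> t \<in> {0..L} \<Longrightarrow> s \<le> t \<Longrightarrow> t - s \<le> C * (\<phi> t - \<phi> s)"
    and upper: "\<And>s t. s \<in> {0..L} \<Longrightarrow> t \<in> {0..L} \<Longrightarrow> s \<le> t \<Longrightarrow> \<phi> t - \<phi> s \<le> D * (t - s)"
begin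

lemma bi_Lipschitz_mono: "s \<in> {0..L} \<Longrightarrow> t \<in> {0..L} \<Longrightarrow> s \<le> t \<Longrightarrow> \<phi> s \<le> \<phi> t"
  using lower[of s t] C by (smt (verit) zero_less_mult_iff mult_le_0_iff)

lemma bi_Lipschitz_lower: "s \<in> {0..L} \<Longrightarrow> t \<in> {0..L} \<Longrightarrow> \<bar>s - t\<bar> \<le> C * \<bar>\<phi> s - \<phi> t\<bar>"
  using lower[of s t] lower[of t s] bi_Lipschitz_mono[of s t] bi_Lipschitz_mono[of t s] by (cases "s \<le> t") auto

lemma bi_Lipschitz_upper: "s \<in> {0..L} \<Longrightarrow> t \<in> {0..L} \<Longrightarrow> \<bar>\<phi> s - \<phi> t\<bar> \<le> D * \<bar>s - t\<bar>"
  using upper[of s t] upper[of t s] bi_Lipschitz_mono[of s t] bi_Lipschitz_mono[of t s] by (cases "s \<le> t") auto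

lemma bi_Lipschitz_continuous_on: "continuous_on {0..L} \<phi>"
proof (rule lipschitz_on_continuous_on[of "\<bar>D\<bar>"], rule lipschitz_onI)
  fix s t assume "s \<in> {0..L}" "t \<in> {0..L}"
  then have "\<bar>\<phi> s - \<phi> t\<bar> \<le> D * \<bar>s - t\<bar>" by (rule bi_Lipschitz_upper)
  also have "\<dots> \<le> \<bar>D\<bar> * \<bar>s - t\<bar>" by (intro mult_right_mono) auto
  finally show "dist (\<phi> s) (\<phi> t) \<le> \<bar>D\<bar> * dist s t" by (simp add: dist_real_def)
qed simp

lemma bi_Lipschitz_inj_on: "inj_on \<phi> {0..L}"
proof (rule inj_onI)
  fix s t assume "s \<in> {0..L}" "t \<in> {0..L}" "\<phi> s = \<phi> t"
  then show "s = t" using bi_Lipschitz_lower[of s t] by simp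
qed

lemma bi_Lipschitz_image: "\<phi> ` {0..L} = {0..L}"
proof
  show "\<phi> ` {0..L} \<subseteq> {0..L}"
    using bi_Lipschitz_mono[of 0] bi_Lipschitz_mono[of _ L] L_pos \<phi>0 \<phi>L by fastforce
  show "{0..L} \<subseteq> \<phi> ` {0..L}"
  proof
    fix y assume "y \<in> {0..L}"
    then show "y \<in> \<phi> ` {0..L}" using IVT'[of \<phi> 0 y L] bi_Lipschitz_continuous_on \<phi>0 \<phi>L L_pos by force
  qed
qed

text \<open>
A continuous bijection of a compact Hausdorff space is a homeomorphism. The two pieces of the map fit
together because the frontier of the arc is contained in its two endpoints, which are fixed.
\<close>
lemma homeomorphic_arc_map: "homeomorphic_map X X (arc_map \<phi>)"
proof (rule continuous_imp_homeomorphic_map[OF _ compact Hausdorff])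
  have inner: "continuous_map (subtopology X arc) X (\<lambda>x. \<gamma> (\<phi> (arc_coord x)))"
  proof -
    have "homeomorphic_map (top_of_set {0..L}) (subtopology X arc) \<gamma>"
    proof (rule continuous_imp_homeomorphic_map)
      show "continuous_map (top_of_set {0..L}) (subtopology X arc) \<gamma>"
        using \<gamma>_cont by (auto simp: continuous_map_in_subtopology arc_def)
      show "compact_space (top_of_set {0..L})" by (simp add: compact_space_subtopology)
      show "Hausdorff_space (subtopology X arc)" using Hausdorff by (rule Hausdorff_space_subtopology)
      show "\<gamma> ` topspace (top_of_set {0..L}) = topspace (subtopology X arc)"
        using arc_subset by (auto simp: arc_def)
      show "inj_on \<gamma> (topspace (top_of_set {0..L}))" using \<gamma>_inj by simp
    qed
    then obtain \<theta> where \<theta>: "homeomorphic_maps (top_of_set {0..L}) (subtopology X arc) \<gamma> \<theta>"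
      using homeomorphic_map_maps by blast
    then have "continuous_map (subtopology X arc) (top_of_set {0..L}) \<theta>"
      by (simp add: homeomorphic_maps_def)
    moreover have "arc_coord x = \<theta> x" if "x \<in> topspace (subtopology X arc)" for x
      using that \<theta> arc_coord_\<gamma> unfolding homeomorphic_maps_def by (auto simp: arc_def)
    ultimately have coord: "continuous_map (subtopology X arc) (top_of_set {0..L}) arc_coord"
      by (metis continuous_map_eq)
    have "continuous_map (top_of_set {0..L}) (top_of_set {0..L}) \<phi>"
      using bi_Lipschitz_continuous_on bi_Lipschitz_image by (auto simp: continuous_map_in_subtopology)
    from continuous_map_compose[OF continuous_map_compose[OF coord this] \<gamma>_cont]
    show ?thesis by (simp add: o_def)
  qed
  have "continuous_map X X (\<lambda>x. if x \<in> arc then \<gamma> (\<phi> (arc_coord x)) else x)"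
  proof (rule continuous_map_cases)
    show "continuous_map (subtopology X (X closure_of {x. x \<in> arc})) X (\<lambda>x. \<gamma> (\<phi> (arc_coord x)))"
      using inner closedin_arc by (simp add: closure_of_closedin)
    show "continuous_map (subtopology X (X closure_of {x. x \<notin> arc})) X (\<lambda>x. x)"
      by (simp add: continuous_map_from_subtopology)
    fix x assume "x \<in> X frontier_of {x. x \<in> arc}"
    then have x: "x \<in> arc" "x \<notin> X interior_of arc"
      using closedin_arc by (auto simp: frontier_of_def closure_of_closedin)
    moreover have "\<gamma> ` {0<..<L} \<subseteq> X interior_of arc"
      using \<gamma>_open by (intro interior_of_maximal) (auto simp: arc_def)
    ultimately have "arc_coord x \<notin> {0<..<L}" using \<gamma>_arc_coord[OF x(1)] by force
    then have "arc_coord x = 0 \<or> arc_coord x = L" using arc_coord_in[OF x(1)] by auto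
    then show "\<gamma> (\<phi> (arc_coord x)) = x" using \<gamma>_arc_coord[OF x(1)] \<phi>0 \<phi>L by auto
  qed
  then show "continuous_map X X (arc_map \<phi>)"
    by (rule continuous_map_eq) (simp add: arc_map_def)
  have X_eq: "topspace X = arc \<union> (topspace X - arc)" using arc_subset by blast
  have img1: "arc_map \<phi> ` arc = arc"
    using arc_map_\<gamma>_image[of "{0..L}" \<phi>] by (simp add: arc_def bi_Lipschitz_image)
  have img2: "arc_map \<phi> ` (topspace X - arc) = topspace X - arc"
    by (force simp: arc_map_outside)
  show "arc_map \<phi> ` topspace X = topspace X"
    by (subst (1 2) X_eq) (simp only: image_Un img1 img2)
  have inj1: "inj_on (arc_map \<phi>) arc"
  proof (rule inj_onI)
    fix x y assume xy: "x \<in> arc" "y \<in> arc" "arc_map \<phi> x = arc_map \<phi> y"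
    then obtain s t where st: "s \<in> {0..L}" "t \<in> {0..L}" "x = \<gamma> s" "y = \<gamma> t" by (auto simp: arc_def)
    then have "\<gamma> (\<phi> s) = \<gamma> (\<phi> t)" using xy by (simp add: arc_map_\<gamma>)
    moreover have "\<phi> s \<in> {0..L}" "\<phi> t \<in> {0..L}" using st bi_Lipschitz_image by blast+
    ultimately have "\<phi> s = \<phi> t" using \<gamma>_inj by (meson inj_onD)
    then show "x = y" using bi_Lipschitz_inj_on st by (metis inj_onD)
  qed
  have inj2: "inj_on (arc_map \<phi>) (topspace X - arc)"
    by (rule inj_onI) (simp add: arc_map_outside)
  have "inj_on (arc_map \<phi>) (arc \<union> (topspace X - arc))"
    unfolding inj_on_Un using inj1 inj2 img1 img2 by (auto simp: Diff_triv)
  then show "inj_on (arc_map \<phi>) (topspace X)" using X_eq by simp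
qed

text \<open>
On the arc \<open>\<mu>\<close> is Lebesgue measure, and a bi-Lipschitz map preserves Lebesgue null sets in both
directions.
\<close>
lemma arc_map_in_H_bac: "arc_map \<phi> \<in> carrier (H_bac X \<mu>)"
  unfolding H_bac_iff
proof (intro conjI ballI homeomorphic_arc_map)
  show "arc_map \<phi> \<in> extensional (topspace X)" by (simp add: arc_map_def)
  fix A assume A: "A \<in> sets \<mu>"
  have AX: "A \<subseteq> topspace X" using A sets.sets_into_space space_eq by metis
  obtain B where B: "B \<in> sets borel" "B \<subseteq> {0..L}" "A \<inter> arc = \<gamma> ` B"
    using arc_Int_sets_eq_\<gamma>_image[OF A] by metis
  have arc_sets: "arc \<in> sets \<mu>" by (rule closedin_sets[OF closedin_arc])
  have "arc_map \<phi> ` (A \<inter> arc) \<in> sets \<mu>"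
    using A arc_sets by (intro homeomorphic_image_sets[OF homeomorphic_arc_map]) auto
  then have gB: "\<gamma> ` \<phi> ` B \<in> sets \<mu>" using B by (simp add: arc_map_\<gamma>_image)
  have \<phi>B: "\<phi> ` B \<subseteq> {0..L}" using B bi_Lipschitz_image by blast
  then have sub: "\<gamma> ` \<phi> ` B \<subseteq> arc" unfolding arc_def by blast
  obtain B' where B': "B' \<in> sets borel" "B' \<subseteq> {0..L}" "\<gamma> ` \<phi> ` B \<inter> arc = \<gamma> ` B'"
    using arc_Int_sets_eq_\<gamma>_image[OF gB] by metis
  then have "\<gamma> ` B' = \<gamma> ` \<phi> ` B" using sub by blast
  then have "B' = \<phi> ` B" using inj_on_image_eq_iff[OF \<gamma>_inj B'(2) \<phi>B] by simp
  then have \<phi>B_borel: "\<phi> ` B \<in> sets borel" using B' by simp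
  have split: "A = \<gamma> ` B \<union> (A - arc)" using B by blast
  have "emeasure \<mu> A = 0 \<longleftrightarrow> emeasure \<mu> (\<gamma> ` B) = 0 \<and> emeasure \<mu> (A - arc) = 0"
  proof -
    have "emeasure \<mu> (\<gamma> ` B \<union> (A - arc)) = emeasure \<mu> (\<gamma> ` B) + emeasure \<mu> (A - arc)"
      using A arc_sets B by (intro plus_emeasure[symmetric]) (auto simp flip: B(3))
    then show ?thesis using split by simp
  qed
  moreover have "emeasure \<mu> (arc_map \<phi> ` A) = 0 \<longleftrightarrow> emeasure \<mu> (\<gamma> ` \<phi> ` B) = 0 \<and> emeasure \<mu> (A - arc) = 0"
  proof -
    have "arc_map \<phi> ` (A - arc) = A - arc" using AX by (force simp: arc_map_outside)
    then have "arc_map \<phi> ` A = \<gamma> ` \<phi> ` B \<union> (A - arc)"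
      using split arc_map_\<gamma>_image[OF B(2), of \<phi>] by (metis image_Un)
    moreover have "emeasure \<mu> (\<gamma> ` \<phi> ` B \<union> (A - arc)) = emeasure \<mu> (\<gamma> ` \<phi> ` B) + emeasure \<mu> (A - arc)"
      using A arc_sets gB sub by (intro plus_emeasure[symmetric]) auto
    ultimately show ?thesis by simp
  qed
  moreover have "negligible (\<phi> ` B) \<longleftrightarrow> negligible B"
  proof
    assume "negligible B"
    then show "negligible (\<phi> ` B)"
      by (rule negligible_Lipschitz_image_real) (use B bi_Lipschitz_upper in blast)
  next
    assume *: "negligible (\<phi> ` B)"
    have inv: "inv_into {0..L} \<phi> (\<phi> t) = t" if "t \<in> B" for t
      using that B bi_Lipschitz_inj_on by (intro inv_into_f_f) auto
    have "negligible (inv_into {0..L} \<phi> ` \<phi> ` B)"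
    proof (rule negligible_Lipschitz_image_real[OF *])
      fix s t assume "s \<in> \<phi> ` B" "t \<in> \<phi> ` B"
      then obtain s' t' where "s' \<in> B" "t' \<in> B" "s = \<phi> s'" "t = \<phi> t'" by blast
      then show "\<bar>inv_into {0..L} \<phi> s - inv_into {0..L} \<phi> t\<bar> \<le> C * \<bar>s - t\<bar>"
        using bi_Lipschitz_lower[OF subsetD[OF B(2)] subsetD[OF B(2)]] inv by simp
    qed
    moreover have "inv_into {0..L} \<phi> ` \<phi> ` B = B" using inv by (force simp: image_image)
    ultimately show "negligible B" by simp
  qed
  ultimately show "emeasure \<mu> A = 0 \<longleftrightarrow> emeasure \<mu> (arc_map \<phi> ` A) = 0"
    using emeasure_\<gamma>_image[OF B(1,2)] emeasure_\<gamma>_image[OF \<phi>B_borel \<phi>B]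
    by (simp add: emeasure_lborel_eq_0_iff_negligible[OF B(1)] emeasure_lborel_eq_0_iff_negligible[OF \<phi>B_borel])
qed

end

section \<open>Oscillating homeomorphisms\<close>

text \<open>
In parameters, a compact set inside an open set keeps a positive distance from the complement.
\<close>
lemma tau_co_limit_arc_map:
  assumes \<phi>: "\<And>n. arc_map (\<phi> n) \<in> carrier (H_bac X \<mu>)"
    and maps: "\<And>n t. t \<in> {0..L} \<Longrightarrow> \<phi> n t \<in> {0..L}"
    and near: "\<And>n t. t \<in> {0..L} \<Longrightarrow> \<bar>\<phi> n t - t\<bar> \<le> c n" and c: "c \<longlonglongrightarrow> 0"
  shows "limitin (tau_co X \<mu>) (\<lambda>n. arc_map (\<phi> n)) \<one>\<^bsub>H_bac X \<mu>\<^esub> sequentially"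
  unfolding tau_co_def limitin_subtopology compact_open_topology_def limitin_topology_generated_by
proof (intro conjI ballI impI)
  let ?e = "\<one>\<^bsub>H_bac X \<mu>\<^esub>"
  let ?S = "{{f. f \<in> extensional (topspace X) \<and> continuous_map X X f \<and> f ` K \<subseteq> U} | K U.
        compactin X K \<and> openin X U}"
  show "?e \<in> carrier (H_bac X \<mu>)" by (rule one_in_H_bac)
  show "\<forall>\<^sub>F n in sequentially. arc_map (\<phi> n) \<in> carrier (H_bac X \<mu>)" using \<phi> by simp
  have mem: "f \<in> extensional (topspace X) \<and> continuous_map X X f" if "f \<in> carrier (H_bac X \<mu>)" for f
    using that by (simp add: H_bac_iff homeomorphic_imp_continuous_map)
  have "?e \<in> {f. f \<in> extensional (topspace X) \<and> continuous_map X X f \<and> f ` {} \<subseteq> topspace X}"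
    using mem[OF one_in_H_bac] by simp
  moreover have "\<dots> \<in> ?S" using compactin_empty openin_topspace by blast
  ultimately show "?e \<in> \<Union>?S" by (rule UnionI[rotated])
  fix W assume "W \<in> ?S" "?e \<in> W"
  then obtain K U where W: "W = {f. f \<in> extensional (topspace X) \<and> continuous_map X X f \<and> f ` K \<subseteq> U}"
    and K: "compactin X K" and U: "openin X U" and eKU: "?e ` K \<subseteq> U" by blast
  have KX: "K \<subseteq> topspace X" using K compactin_subset_topspace by blast
  have KU: "K \<subseteq> U" using eKU image_one[OF KX] by simp
  define V where "V = {t \<in> {0..L}. \<gamma> t \<in> U}"
  define J where "J = {t \<in> {0..L}. \<gamma> t \<in> K}"
  have "openin (top_of_set {0..L}) V"
    using openin_continuous_map_preimage[OF \<gamma>_cont U] by (simp add: V_def)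
  then obtain V' where V': "open V'" "V = {0..L} \<inter> V'" by (auto simp: openin_open)
  have "closedin X K" using K Hausdorff compactin_imp_closedin by blast
  then have "closedin (top_of_set {0..L}) J"
    using closedin_continuous_map_preimage[OF \<gamma>_cont, of K] by (simp add: J_def)
  then have J: "compact J" using closedin_compact by blast
  have "J \<subseteq> V'" using KU V' unfolding J_def V_def by blast
  then obtain e where e: "0 < e" "(\<Union>t\<in>J. ball t e) \<subseteq> V'"
    using compact_subset_open_imp_ball_epsilon_subset[OF J V'(1)] by metis
  have "\<forall>\<^sub>F n in sequentially. c n < e" using c e(1) by (rule order_tendstoD)
  then show "\<forall>\<^sub>F n in sequentially. arc_map (\<phi> n) \<in> W"
  proof (rule eventually_mono)
    fix n assume n: "c n < e"
    have "arc_map (\<phi> n) x \<in> U" if x: "x \<in> K" for x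
    proof (cases "x \<in> arc")
      case True
      then obtain t where t: "t \<in> {0..L}" "x = \<gamma> t" by (auto simp: arc_def)
      then have tJ: "t \<in> J" using x by (simp add: J_def)
      have "\<phi> n t \<in> ball t e" using near[OF t(1), of n] n by (simp add: dist_real_def)
      then have "\<phi> n t \<in> V" using e(2) tJ maps[OF t(1)] V'(2) by blast
      then show ?thesis using t by (simp add: arc_map_\<gamma> V_def)
    next
      case False
      then have "arc_map (\<phi> n) x = x" using x KX by (intro arc_map_outside) auto
      then show ?thesis using x KU by auto
    qed
    then show "arc_map (\<phi> n) \<in> W" unfolding W using mem[OF \<phi>] by blast
  qed
qed

lemma measure_\<gamma>_image_intervals:
  assumes p: "0 \<le> e" "e \<le> p" "real m * p \<le> L"
  defines "S \<equiv> (\<Union>k<m. {real k * p..<real k * p + e})"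
  shows "S \<subseteq> {0..L}" "\<gamma> ` S \<in> sets \<mu>" "measure \<mu> (\<gamma> ` S) = real m * e"
proof -
  have le: "real k * p + p \<le> real l * p" if "k < l" for k l
  proof -
    have "(real k + 1) * p \<le> real l * p" using that p by (intro mult_right_mono) auto
    then show ?thesis by (simp add: algebra_simps)
  qed
  have I: "{real k * p..<real k * p + e} \<subseteq> {0..L}" if "k < m" for k
  proof
    fix t assume "t \<in> {real k * p..<real k * p + e}"
    moreover have "0 \<le> real k * p" using p by (intro mult_nonneg_nonneg) auto
    ultimately show "t \<in> {0..L}" using le[OF that] p unfolding atLeastLessThan_iff atLeastAtMost_iff by linarith
  qed
  show S: "S \<subseteq> {0..L}" unfolding S_def using I by blast
  show "\<gamma> ` S \<in> sets \<mu>" by (rule \<gamma>_image_sets[OF _ S]) (simp add: S_def)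
  have "emeasure \<mu> (\<gamma> ` S) = emeasure lborel S"
    by (rule emeasure_\<gamma>_image[OF _ S]) (simp add: S_def)
  also have "\<dots> = (\<Sum>k<m. emeasure lborel {real k * p..<real k * p + e})"
    unfolding S_def
  proof (rule sum_emeasure[symmetric])
    show "disjoint_family_on (\<lambda>k. {real k * p..<real k * p + e}) {..<m}"
      unfolding disjoint_family_on_def
    proof (intro ballI impI)
      fix k l :: nat assume "k \<noteq> l"
      then show "{real k * p..<real k * p + e} \<inter> {real l * p..<real l * p + e} = {}"
        using le[of k l] le[of l k] p by (cases "k < l") auto
    qed
  qed auto
  also have "\<dots> = ennreal (real m * e)" using p by (simp add: ennreal_mult' ennreal_of_nat_eq_real_of_nat)
  finally show "measure \<mu> (\<gamma> ` S) = real m * e" using p by (simp add: measure_def)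
qed

text \<open>
The perturbation \<open>c (1 - cos(\<omega> t))\<close> with \<open>c \<omega> = 1/2\<close> has amplitude of order \<open>1/\<omega>\<close> but changes
the slope by an amount independent of \<open>\<omega>\<close>. On each half period that starts at a minimum it
lengthens the interval by \<open>2 c\<close>. The \<open>n + 1\<close> such half periods in \<open>[0, L]\<close> together gain the fixed
length \<open>L / (2 \<pi>)\<close>, so the distance to the identity stays at least \<open>L / \<pi>\<close>.
\<close>
lemma tau_co_limit_not_tau_ac_limit_exists:
  "\<exists>g :: nat \<Rightarrow> 'a \<Rightarrow> 'a. (\<forall>n. g n \<in> carrier (H_bac X \<mu>)) \<and>
     limitin (tau_co X \<mu>) g \<one>\<^bsub>H_bac X \<mu>\<^esub> sequentially \<and>
     \<not> limitin (tau_ac X \<mu>) g \<one>\<^bsub>H_bac X \<mu>\<^esub> sequentially"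
proof -
  \<comment> \<open>Period \<open>p\<^sub>n\<close>, frequency \<open>\<omega>\<^sub>n\<close> and amplitude \<open>c\<^sub>n\<close> of the perturbation; note \<open>c\<^sub>n \<omega>\<^sub>n = 1/2\<close>.\<close>
  define p where "p n = L / real (Suc n)" for n
  define w where "w n = 2 * pi / p n" for n
  define c where "c n = 1 / (2 * w n)" for n
  define \<phi> where "\<phi> n t = t + c n * (1 - cos (w n * t))" for n t
  have p: "0 < p n" and pn: "real (Suc n) * p n = L" for n
    using L_pos by (simp_all add: p_def)
  have w: "0 < w n" and c: "0 < c n" and cw: "c n * w n = 1 / 2" for n
    using p[of n] by (simp_all add: w_def c_def)
  have cos_le: "\<bar>cos x - cos y\<bar> \<le> \<bar>x - y\<bar>" for x y :: real
  proof -
    have "\<bar>cos x - cos y\<bar> = 2 * (\<bar>sin ((x + y) / 2)\<bar> * \<bar>sin ((y - x) / 2)\<bar>)"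
      by (simp add: cos_diff_cos abs_mult)
    also have "\<dots> \<le> 2 * (1 * \<bar>(y - x) / 2\<bar>)"
      by (intro mult_left_mono mult_mono abs_sin_x_le_abs_x) auto
    finally show ?thesis by simp
  qed
  have Lip: "\<bar>(\<phi> n t - t) - (\<phi> n s - s)\<bar> \<le> (t - s) / 2" if "s \<le> t" for n s t
  proof -
    have "\<bar>(\<phi> n t - t) - (\<phi> n s - s)\<bar> = c n * \<bar>cos (w n * s) - cos (w n * t)\<bar>"
      using c[of n] by (simp add: \<phi>_def abs_mult flip: right_diff_distrib)
    also have "\<dots> \<le> c n * \<bar>w n * s - w n * t\<bar>"
      using c[of n] by (intro mult_left_mono cos_le) simp
    also have "\<dots> = (c n * w n) * (t - s)"
      using w[of n] that by (simp add: abs_mult flip: right_diff_distrib)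
    finally show ?thesis by (simp add: cw)
  qed
  have lower: "t - s \<le> 2 * (\<phi> n t - \<phi> n s)" and upper: "\<phi> n t - \<phi> n s \<le> 2 * (t - s)"
    if "s \<le> t" for n s t
    using abs_le_D1[OF Lip[OF that, of n]] abs_le_D2[OF Lip[OF that, of n]] that by (simp_all add: field_simps)
  have cos1: "cos (w n * (real k * p n)) = 1" for n k
  proof -
    have "w n * (real k * p n) = 2 * real k * pi" using p[of n] by (simp add: w_def)
    then show ?thesis by (simp only: cos_2npi)
  qed
  have cos2: "cos (w n * (real k * p n + p n / 2)) = -1" for n k
  proof -
    have "w n * (real k * p n + p n / 2) = 2 * real k * pi + pi" using p[of n] by (simp add: w_def field_simps)
    then show ?thesis by (simp only: cos_periodic_pi cos_2npi)
  qed
  have \<phi>k: "\<phi> n (real k * p n) = real k * p n"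
    "\<phi> n (real k * p n + p n / 2) = real k * p n + (p n / 2 + 2 * c n)" for n k
    unfolding \<phi>_def cos1 cos2 by simp_all
  have \<phi>0: "\<phi> n 0 = 0" and \<phi>L: "\<phi> n L = L" for n
    using \<phi>k(1)[of n 0] \<phi>k(1)[of n "Suc n"] by (simp_all add: pn del: of_nat_Suc)
  note conds = \<phi>0 \<phi>L zero_less_numeral lower upper
  define g where "g n = arc_map (\<phi> n)" for n
  have g: "g n \<in> carrier (H_bac X \<mu>)" for n
    unfolding g_def by (rule arc_map_in_H_bac[OF conds])
  have \<phi>_img: "\<phi> n ` {0..L} = {0..L}" for n by (rule bi_Lipschitz_image[OF conds])
  have "limitin (tau_co X \<mu>) g \<one>\<^bsub>H_bac X \<mu>\<^esub> sequentially"
    unfolding g_def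
  proof (rule tau_co_limit_arc_map)
    show "\<phi> n t \<in> {0..L}" if "t \<in> {0..L}" for n t using \<phi>_img that by blast
    show "\<bar>\<phi> n t - t\<bar> \<le> 2 * c n" for n t
    proof -
      have "\<bar>1 - cos (w n * t)\<bar> \<le> 2" using cos_le_one[of "w n * t"] cos_ge_minus_one[of "w n * t"] by linarith
      then have "c n * \<bar>1 - cos (w n * t)\<bar> \<le> c n * 2" using c[of n] by (intro mult_left_mono) auto
      then show ?thesis using c[of n] by (simp add: \<phi>_def abs_mult)
    qed
    have "c n = L / (4 * pi) * inverse (real (Suc n))" for n by (simp add: c_def w_def p_def field_simps)
    moreover have "(\<lambda>n. 2 * (L / (4 * pi) * inverse (real (Suc n)))) \<longlonglongrightarrow> 2 * (L / (4 * pi) * 0)"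
      by (intro tendsto_mult tendsto_const LIMSEQ_inverse_real_of_nat)
    ultimately show "(\<lambda>n. 2 * c n) \<longlonglongrightarrow> 0" by simp
  qed (use g in \<open>simp add: g_def\<close>)
  moreover have "\<not> limitin (tau_ac X \<mu>) g \<one>\<^bsub>H_bac X \<mu>\<^esub> sequentially"
  proof
    assume "limitin (tau_ac X \<mu>) g \<one>\<^bsub>H_bac X \<mu>\<^esub> sequentially"
    then have "\<forall>\<^sub>F n in sequentially. rho_ac \<mu> \<one>\<^bsub>H_bac X \<mu>\<^esub> (g n) < L / pi"
      using limitin_tau_ac_one_iff[of g, OF g] L_pos by simp
    then obtain n where n: "rho_ac \<mu> \<one>\<^bsub>H_bac X \<mu>\<^esub> (g n) < L / pi"
      by (auto simp: eventually_sequentially)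
    \<comment> \<open>The half periods on which the perturbation grows; \<open>half\<close> keeps their images disjoint.\<close>
    let ?S = "\<lambda>e. \<Union>k<Suc n. {real k * p n..<real k * p n + e}"
    have "real (Suc n) * (2 * c n) = real (Suc n) * p n / (2 * pi)"
      by (simp add: c_def w_def del: of_nat_Suc)
    then have c_eq: "real (Suc n) * (2 * c n) = L / (2 * pi)" by (simp only: pn)
    have "4 * c n \<le> p n" using pi_gt3 p[of n] by (simp add: c_def w_def field_simps)
    then have half: "p n / 2 + 2 * c n \<le> p n" by simp
    note S = measure_\<gamma>_image_intervals[of "p n / 2" "p n" "Suc n"]
    note S' = measure_\<gamma>_image_intervals[of "p n / 2 + 2 * c n" "p n" "Suc n"]
    have "g n ` \<gamma> ` ?S (p n / 2) = \<gamma> ` \<phi> n ` ?S (p n / 2)"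
      unfolding g_def by (rule arc_map_\<gamma>_image) (rule S, use p[of n] pn[of n] in auto)
    also have "\<phi> n ` ?S (p n / 2) = ?S (p n / 2 + 2 * c n)"
      unfolding image_UN
    proof (rule SUP_cong[OF refl])
      fix k
      show "\<phi> n ` {real k * p n..<real k * p n + p n / 2} = {real k * p n..<real k * p n + (p n / 2 + 2 * c n)}"
        (is "\<phi> n ` {?a..<?b} = {?a..<?b'}")
      proof (intro equalityI subsetI)
        fix y assume "y \<in> \<phi> n ` {?a..<?b}"
        then obtain t where "?a \<le> t" "t < ?b" "y = \<phi> n t" by auto
        then show "y \<in> {?a..<?b'}"
          using lower[of ?a t n] lower[of t ?b n] \<phi>k[of n k] by auto
      next
        fix y assume y: "y \<in> {?a..<?b'}"
        have "continuous_on {?a..?b} (\<phi> n)" unfolding \<phi>_def[abs_def] by (intro continuous_intros)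
        then obtain t where t: "?a \<le> t" "t \<le> ?b" "\<phi> n t = y"
          using IVT'[of "\<phi> n" ?a y ?b] y \<phi>k[of n k] p[of n] by auto
        moreover have "t \<noteq> ?b" using t y \<phi>k(2)[of n k] by auto
        ultimately show "y \<in> \<phi> n ` {?a..<?b}" by auto
      qed
    qed
    finally have "measure \<mu> (g n ` \<gamma> ` ?S (p n / 2)) - measure \<mu> (\<gamma> ` ?S (p n / 2)) =
        real (Suc n) * (p n / 2 + 2 * c n) - real (Suc n) * (p n / 2)"
      using S(3) S'(3) p[of n] c[of n] pn[of n] half by (simp del: of_nat_Suc)
    also have "\<dots> = L / (2 * pi)" using c_eq by (simp add: algebra_simps)
    finally have "L / (2 * pi) \<le> rho_ac \<mu> \<one>\<^bsub>H_bac X \<mu>\<^esub> (g n) / 2"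
      using measure_image_diff_le_rho_ac[OF g[of n] S(2)] p[of n] pn[of n] by auto
    then show False using n by simp
  qed
  ultimately show ?thesis using g by blast
qed

end

section \<open>One-dimensional Oxtoby--Ulam pairs\<close>

theorem theorem4:
  fixes X :: "'a topology" and \<mu> :: "'a measure"
  assumes "OU_pair 1 X \<mu>"
  shows "(\<forall>g :: nat \<Rightarrow> 'a \<Rightarrow> 'a.
            (\<forall>n. g n \<in> carrier (H_bac X \<mu>)) \<and>
            limitin (tau_co X \<mu>) g \<one>\<^bsub>H_bac X \<mu>\<^esub> sequentially \<and>
            \<not> limitin (tau_ac X \<mu>) g \<one>\<^bsub>H_bac X \<mu>\<^esub> sequentially \<longrightarrow>
            \<not> roelcke_totally_bounded (H_bac X \<mu>) (tau_ac X \<mu>) (range g)) \<and>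
         \<not> roelcke_precompact (H_bac X \<mu>) (tau_ac X \<mu>)"
proof
  interpret finite_frontier_base_measure X \<mu>
    by (rule OU_pair_1_finite_frontier_base_measure[OF assms])
  show main: "\<forall>g :: nat \<Rightarrow> 'a \<Rightarrow> 'a.
            (\<forall>n. g n \<in> carrier (H_bac X \<mu>)) \<and>
            limitin (tau_co X \<mu>) g \<one>\<^bsub>H_bac X \<mu>\<^esub> sequentially \<and>
            \<not> limitin (tau_ac X \<mu>) g \<one>\<^bsub>H_bac X \<mu>\<^esub> sequentially \<longrightarrow>
            \<not> roelcke_totally_bounded (H_bac X \<mu>) (tau_ac X \<mu>) (range g)"
    using not_roelcke_totally_bounded_if_tau_co_limit by blast
  have OU: "topological_manifold 1 X" "topspace X \<noteq> {}"
    "\<And>U. openin X U \<Longrightarrow> U \<noteq> {} \<Longrightarrow> 0 < emeasure \<mu> U"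
    using assms unfolding OU_pair_def by blast+
  obtain L \<gamma> where "0 < L" "continuous_map (top_of_set {0..L}) X \<gamma>" "inj_on \<gamma> {0..L}"
    "openin X (\<gamma> ` {0<..<L})" "\<And>s. s \<in> {0..L} \<Longrightarrow> measure \<mu> (\<gamma> ` {0..s}) = (s::real)"
    using measure_parametrized_arc_exists[OF OU] by metis
  then interpret measure_parametrized_arc X \<mu> L \<gamma>
    by unfold_locales
  obtain g :: "nat \<Rightarrow> 'a \<Rightarrow> 'a" where g: "\<And>n. g n \<in> carrier (H_bac X \<mu>)"
    and "\<not> roelcke_totally_bounded (H_bac X \<mu>) (tau_ac X \<mu>) (range g)"
    using tau_co_limit_not_tau_ac_limit_exists main by metis
  moreover have "range g \<subseteq> carrier (H_bac X \<mu>)" using g by blast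
  ultimately show "\<not> roelcke_precompact (H_bac X \<mu>) (tau_ac X \<mu>)"
    unfolding roelcke_precompact_def roelcke_totally_bounded_def by (meson subset_trans)
qed

end
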